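(* Let $A\in\mathbb{H}^{m\times n}$, let $M$ and $N$ be positive definite quaternion matrices of order $m$ and $n$, and let $A^{\sharp}A\in\mathbb{H}^{n\times n}$ be non-Hermitian. Let $b\in\mathbb{H}^{m\times 1}$, and let $\tilde x=(\tilde x_1,\dots,\tilde x_n)^{T}$ be the weighted Moore-Penrose solution of the right system $Ax=b$. (i) If $\mathrm{rank}\,A=r\le m<n$, then for all $i=1,\dots,n$ $$\tilde x_i=\frac{\sum_{k=1}^{n} n^{-1/2}_{ik}\sum_{\beta\in J_{r,n}\{k\}}\mathrm{cdet}_k\left(\left(N^{-1/2}A^{*}MAN^{-1/2}\right)_{.k}(\hat f)\right)^{\beta}_{\beta}}{\sum_{\beta\in J_{r,n}}\left|\left(N^{-1/2}A^{*}MAN^{-1/2}\right)^{\beta}_{\beta}\right|},$$ where $\hat f=(N^{-1/2}A^{*}M)b$ and $n^{-1/2}_{ik}$ is the $(i,k)$ entry of $N^{-1/2}$. (ii) If $\mathrm{rank}\,A=n$, then for all $i=1,\dots,n$ $$\tilde x_i=\frac{\mathrm{cdet}_i\left(\left(A^{*}MA\right)_{.i}(\check f)\right)}{\det(A^{*}MA)},$$ where $\check f=A^{*}Mb$.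
   Context: $\mathbb{H}$ is the skew field of real quaternions; $A^{*}$ is the conjugate transpose; $B$ is Hermitian if $B^{*}=B$; $P$ is positive definite if it is Hermitian and $x^{*}Px>0$ for all nonzero columns $x$; $P^{1/2}$ is then its unique positive definite square root, and $N^{-1/2}=(N^{-1})^{1/2}$. $A^{\sharp}:=N^{-1}A^{*}M$. The weighted Moore-Penrose inverse $A^{\dagger}_{M,N}$ is the unique $X\in\mathbb{H}^{n\times m}$ with $AXA=A$, $XAX=X$, $(MAX)^{*}=MAX$, $(NXA)^{*}=NXA$. The weighted Moore-Penrose solution of $Ax=b$ is $\tilde x=A^{\dagger}_{M,N}b$. Column determinants of $B=(b_{ij})\in\mathbb{H}^{n\times n}$. For fixed $j$, write each $\tau\in S_n$ as a product of $r=r(\tau)$ disjoint cycles (1-cycles included) $\tau=(j_{k_r+l_r}\ldots j_{k_r+1}\,j_{k_r})\cdots(j_{k_2+l_2}\ldots j_{k_2+1}\,j_{k_2})(j_{k_1+l_1}\ldots j_{k_1+1}\,j_{k_1}\,j)$, the last (rightmost) cycle ending with $j$, every other cycle ending with its smallest element, and $j_{k_2}<j_{k_3}<\dots<j_{k_r}$. Then $$\mathrm{cdet}_j B=\sum_{\tau\in S_n}(-1)^{n-r}\,b_{j_{k_r}j_{k_r+l_r}}\cdots b_{j_{k_r+1}j_{k_r}}\cdots b_{j j_{k_1+l_1}}\cdots b_{j_{k_1+1}j_{k_1}}b_{j_{k_1}j}.$$ (A 1-cycle $(s)$ contributes the factor $b_{ss}$.) For Hermitian $B$ all $\mathrm{cdet}_jB$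 coincide and are real; the common value is $\det B$. $B_{.i}(c)$ is $B$ with its $i$-th column replaced by the column $c$. $B^{\beta}_{\beta}$ is the principal submatrix with rows and columns indexed by $\beta$; its rows and columns keep their original indices, so that $\mathrm{cdet}_k(B)^{\beta}_{\beta}$ is the column determinant of the submatrix along the column with original index $k\in\beta$. For Hermitian $B$, $|B^{\beta}_{\beta}|=\det(B^{\beta}_{\beta})$. $L_{k,n}$ ($1\le k\le n$) is the set of strictly increasing sequences of $k$ integers from $\{1,\dots,n\}$; $J_{r,n}=L_{r,n}$, $J_{r,n}\{k\}=\{\beta\in L_{r,n}: k\in\beta\}$; $r\ge1$ is understood. *)

theory Defs
  imports "HOL-Analysis.Analysis" "HOL-Combinatorics.Cycles"
begin

section \<open>Real quaternions\<close>

codatatype quat = Quat (qRe: real) (qIm1: real) (qIm2: real) (qIm3: real)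

lemma quat_eq_iff:
  "x = y \<longleftrightarrow> qRe x = qRe y \<and> qIm1 x = qIm1 y \<and> qIm2 x = qIm2 y \<and> qIm3 x = qIm3 y"
  by (auto intro: quat.expand)

instantiation quat :: ab_group_add
begin

primcorec zero_quat where
    "qRe 0 = 0"
  | "qIm1 0 = 0"
  | "qIm2 0 = 0"
  | "qIm3 0 = 0"

primcorec plus_quat where
    "qRe (x + y) = qRe x + qRe y"
  | "qIm1 (x + y) = qIm1 x + qIm1 y"
  | "qIm2 (x + y) = qIm2 x + qIm2 y"
  | "qIm3 (x + y) = qIm3 x + qIm3 y"

primcorec uminus_quat where
    "qRe (- x) = - qRe x"
  | "qIm1 (- x) = - qIm1 x"
  | "qIm2 (- x) = - qIm2 x"
  | "qIm3 (- x) = - qIm3 x"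

primcorec minus_quat where
    "qRe (x - y) = qRe x - qRe y"
  | "qIm1 (x - y) = qIm1 x - qIm1 y"
  | "qIm2 (x - y) = qIm2 x - qIm2 y"
  | "qIm3 (x - y) = qIm3 x - qIm3 y"

instance
  by standard (simp_all add: quat_eq_iff)

end

instantiation quat :: ring_1
begin

primcorec one_quat where
    "qRe 1 = 1"
  | "qIm1 1 = 0"
  | "qIm2 1 = 0"
  | "qIm3 1 = 0"

primcorec times_quat where
    "qRe (x * y) = qRe x * qRe y - qIm1 x * qIm1 y - qIm2 x * qIm2 y - qIm3 x * qIm3 y"
  | "qIm1 (x * y) = qRe x * qIm1 y + qIm1 x * qRe y + qIm2 x * qIm3 y - qIm3 x * qIm2 y"
  | "qIm2 (x * y) = qRe x * qIm2 y - qIm1 x * qIm3 y + qIm2 x * qRe y + qIm3 x * qIm1 y"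
  | "qIm3 (x * y) = qRe x * qIm3 y + qIm1 x * qIm2 y - qIm2 x * qIm1 y + qIm3 x * qRe y"

instance
  by standard (simp_all add: quat_eq_iff algebra_simps)

end

instantiation quat :: real_div_algebra
begin

primcorec scaleR_quat where
    "qRe (scaleR r x) = r * qRe x"
  | "qIm1 (scaleR r x) = r * qIm1 x"
  | "qIm2 (scaleR r x) = r * qIm2 x"
  | "qIm3 (scaleR r x) = r * qIm3 x"

primcorec inverse_quat where
    "qRe (inverse x) = qRe x / ((qRe x)\<^sup>2 + (qIm1 x)\<^sup>2 + (qIm2 x)\<^sup>2 + (qIm3 x)\<^sup>2)"
  | "qIm1 (inverse x) = - qIm1 x / ((qRe x)\<^sup>2 + (qIm1 x)\<^sup>2 + (qIm2 x)\<^sup>2 + (qIm3 x)\<^sup>2)"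
  | "qIm2 (inverse x) = - qIm2 x / ((qRe x)\<^sup>2 + (qIm1 x)\<^sup>2 + (qIm2 x)\<^sup>2 + (qIm3 x)\<^sup>2)"
  | "qIm3 (inverse x) = - qIm3 x / ((qRe x)\<^sup>2 + (qIm1 x)\<^sup>2 + (qIm2 x)\<^sup>2 + (qIm3 x)\<^sup>2)"

definition "x div y = x * inverse y" for x y :: quat

instance
proof
  have norm_pos: "(qRe x)\<^sup>2 + (qIm1 x)\<^sup>2 + (qIm2 x)\<^sup>2 + (qIm3 x)\<^sup>2 \<noteq> 0" if "x \<noteq> 0" for x
    using that by (simp add: quat_eq_iff add_nonneg_eq_0_iff)
  show "inverse x * x = 1" if "x \<noteq> 0" for x :: quat
    using norm_pos[OF that]
    by (simp add: quat_eq_iff divide_simps) (simp add: algebra_simps power2_eq_square)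
  show "x * inverse x = 1" if "x \<noteq> 0" for x :: quat
    using norm_pos[OF that]
    by (simp add: quat_eq_iff divide_simps) (simp add: algebra_simps power2_eq_square)
qed (simp_all add: quat_eq_iff divide_quat_def algebra_simps)

end

primcorec qcnj :: "quat \<Rightarrow> quat" where
    "qRe (qcnj x) = qRe x"
  | "qIm1 (qcnj x) = - qIm1 x"
  | "qIm2 (qcnj x) = - qIm2 x"
  | "qIm3 (qcnj x) = - qIm3 x"


section \<open>Quaternion matrices\<close>

text \<open>
  An \<open>m \<times> n\<close> matrix has type \<^typ>\<open>quat^'n^'m\<close>.  Where the order of the column indices
  matters (column determinants), the index type is a finite linear order, which is
  order-isomorphic to \<open>{1,\<dots>,n}\<close> for \<open>n = CARD('n)\<close>.
\<close>

definition adj :: "quat^'n^'m \<Rightarrow> quat^'m^'n" where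
  "adj A = (\<chi> i j. qcnj (A $ j $ i))"

definition hermitian :: "quat^'n^'n \<Rightarrow> bool" where
  "hermitian B \<longleftrightarrow> adj B = B"

definition pos_def :: "quat^'n^'n \<Rightarrow> bool" where
  "pos_def P \<longleftrightarrow> hermitian P \<and>
     (\<forall>x. x \<noteq> 0 \<longrightarrow> (\<exists>t>0. (\<Sum>i\<in>UNIV. qcnj (x $ i) * (P *v x) $ i) = of_real t))"

definition msqrt :: "quat^'n^'n \<Rightarrow> quat^'n^'n" where
  "msqrt P = (THE S. pos_def S \<and> S ** S = P)"

definition right_indep_cols :: "quat^'n^'m \<Rightarrow> 'n set \<Rightarrow> bool" where
  "right_indep_cols A S \<longleftrightarrow>
     (\<forall>c :: 'n \<Rightarrow> quat. (\<forall>i. (\<Sum>j\<in>S. A $ i $ j * c j) = 0) \<longrightarrow> (\<forall>j\<in>S. c j = 0))"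

text \<open>The rank is the maximal number of right linearly independent columns.\<close>

definition qrank :: "quat^'n^'m \<Rightarrow> nat" where
  "qrank A = Max (card ` {S. right_indep_cols A S})"

definition weighted_adj :: "quat^'m^'m \<Rightarrow> quat^'n^'n \<Rightarrow> quat^'n^'m \<Rightarrow> quat^'m^'n" where
  "weighted_adj M N A = matrix_inv N ** adj A ** M"

definition weighted_pinv :: "quat^'m^'m \<Rightarrow> quat^'n^'n \<Rightarrow> quat^'n^'m \<Rightarrow> quat^'m^'n" where
  "weighted_pinv M N A = (THE X. A ** X ** A = A \<and> X ** A ** X = X \<and>
     hermitian (M ** A ** X) \<and> hermitian (N ** X ** A))"

definition weighted_solution ::
    "quat^'m^'m \<Rightarrow> quat^'n^'n \<Rightarrow> quat^'n^'m \<Rightarrow> quat^'m \<Rightarrow> quat^'n" where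
  "weighted_solution M N A b = weighted_pinv M N A *v b"

definition replace_col :: "quat^'n^'m \<Rightarrow> 'n \<Rightarrow> quat^'m \<Rightarrow> quat^'n^'m" where
  "replace_col B k c = (\<chi> i j. if j = k then c $ i else B $ i $ j)"


section \<open>Column determinants\<close>

text \<open>
  \<open>cycle_prod B \<tau> s\<close> is the ordered product \<open>b\<^bsub>s,\<tau>(s)\<^esub> b\<^bsub>\<tau>(s),\<tau>(\<tau>(s))\<^esub> \<dots> b\<^bsub>t,s\<^esub>\<close>
  along the cycle of \<open>\<tau>\<close> through \<open>s\<close>.  A cycle written \<open>(j\<^bsub>k+l\<^esub> \<dots> j\<^bsub>k+1\<^esub> j\<^bsub>k\<^esub>)\<close> is read
  as \<open>j\<^bsub>k+l\<^esub> \<mapsto> \<dots> \<mapsto> j\<^bsub>k+1\<^esub> \<mapsto> j\<^bsub>k\<^esub> \<mapsto> j\<^bsub>k+l\<^esub>\<close>.  The opposite reading replaces \<open>\<tau>\<close> by its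
  inverse and leaves the column determinant unchanged.
\<close>

definition cycle_prod :: "quat^'n^'n \<Rightarrow> ('n \<Rightarrow> 'n) \<Rightarrow> 'n \<Rightarrow> quat" where
  "cycle_prod B \<tau> s = prod_list (map (\<lambda>t. B $ t $ \<tau> t) (support \<tau> s))"

text \<open>
  The last elements of the cycles of a permutation \<open>\<tau>\<close> of \<open>\<beta>\<close>, listed from the leftmost
  cycle to the rightmost one: \<open>j\<^bsub>k\<^sub>r\<^esub>, \<dots>, j\<^bsub>k\<^sub>2\<^esub>, j\<close>.  All of them except \<open>j\<close> are the
  smallest elements of their cycles.
\<close>

definition cycle_ends :: "'n::{finite,linorder} set \<Rightarrow> 'n \<Rightarrow> ('n \<Rightarrow> 'n) \<Rightarrow> 'n list" where
  "cycle_ends \<beta> j \<tau> =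
     rev (sorted_list_of_set
       {s \<in> \<beta>. s \<notin> set (support \<tau> j) \<and> (\<forall>t \<in> set (support \<tau> s). s \<le> t)}) @ [j]"

text \<open>
  \<open>cdet \<beta> j B\<close> is the column determinant, along the column with original index \<open>j \<in> \<beta>\<close>,
  of the principal submatrix of \<open>B\<close> with rows and columns indexed by \<open>\<beta>\<close>.
  The full matrix is the case \<open>\<beta> = UNIV\<close>.
\<close>

definition cdet :: "('n::{finite,linorder}) set \<Rightarrow> 'n \<Rightarrow> quat^('n::{finite,linorder})^('n::{finite,linorder}) \<Rightarrow> quat" where
  "cdet \<beta> j B = (\<Sum>\<tau> | \<tau> permutes \<beta>.
     (-1) ^ (card \<beta> - length (cycle_ends \<beta> j \<tau>)) *
     prod_list (map (cycle_prod B \<tau>) (cycle_ends \<beta> j \<tau>)))"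

text \<open>
  For Hermitian \<open>B\<close> and nonempty \<open>\<beta>\<close>: the common real value of all column determinants
  of the principal submatrix indexed by \<open>\<beta>\<close>.
\<close>

definition hdet :: "('n::{finite,linorder}) set \<Rightarrow> quat^('n::{finite,linorder})^('n::{finite,linorder}) \<Rightarrow> real" where
  "hdet \<beta> B = (THE d. \<forall>j\<in>\<beta>. cdet \<beta> j B = of_real d)"

text \<open>Strictly increasing sequences are identified with the sets of their members.\<close>

definition J :: "nat \<Rightarrow> 'n::{finite,linorder} set set" where
  "J r = {\<beta>. card \<beta> = r}"

definition J_at :: "nat \<Rightarrow> 'n::{finite,linorder} \<Rightarrow> 'n set set" where
  "J_at r k = {\<beta> \<in> J r. k \<in> \<beta>}"

end

theory Submission
  imports Defs "HOL-Computational_Algebra.Fundamental_Theorem_Algebra"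
begin

text \<open>
  The sum defining \<open>cdet \<beta> j B\<close> is organised by the cycle through \<open>j\<close>, that is, by the paths in
  \<open>\<beta>\<close> that start at \<open>j\<close>.  For Hermitian \<open>B\<close>, reversing a path conjugates its product, so all
  column determinants are real, and rotating cycles shows that they agree.  Cramer's rule
  follows by cancelling a path and a disjoint cycle against their concatenation.  Counting paths
  by their last vertex gives the Faddeev--LeVerrier recursion
  \<open>C\<^sub>s\<^sub>+\<^sub>1 + C\<^sub>s G = d\<^sub>s I\<close> for the sums \<open>C\<^sub>s\<close> of cofactors and \<open>d\<^sub>s\<close> of principal minors of order \<open>s\<close>.

  Let \<open>R\<close> be the square root of the inverse of \<open>N\<close>, \<open>K = A R\<close>, \<open>G = K\<^sup>* M K\<close> and \<open>r\<close> the rank of \<open>A\<close>.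
  The cofactors of order \<open>r + 1\<close> annihilate \<open>G\<close>, so \<open>C\<^sub>r G / d\<^sub>r\<close> is the orthogonal projection onto
  the range of \<open>G\<close>, and \<open>R C\<^sub>r K\<^sup>* M / d\<^sub>r\<close> satisfies the four equations that define the weighted
  Moore-Penrose inverse.  The square root itself exists because the same recursion yields a
  real polynomial annihilating a given Hermitian matrix.
\<close>

section \<open>Column determinants as sums over paths\<close>

text \<open>The order of the cycles that remain once the distinguished one is split off: each ends
  with its minimum, and the largest minimum comes first.\<close>

definition cycle_mins :: "'n::{finite,linorder} set \<Rightarrow> ('n \<Rightarrow> 'n) \<Rightarrow> 'n list" where
  "cycle_mins \<beta> \<tau> = rev (sorted_list_of_set {s \<in> \<beta>. \<forall>t \<in> set (support \<tau> s). s \<le> t})"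

text \<open>The determinant without a distinguished column. It is the factor left over when one
  cycle is split off from \<open>cdet\<close>; it also makes sense for the empty index set, where
  its value is 1.\<close>

definition mdet :: "('n::{finite,linorder}) set \<Rightarrow> quat^('n::{finite,linorder})^('n::{finite,linorder}) \<Rightarrow> quat" where
  "mdet \<beta> B = (\<Sum>\<tau> | \<tau> permutes \<beta>.
     (-1) ^ (card \<beta> - length (cycle_mins \<beta> \<tau>)) * prod_list (map (cycle_prod B \<tau>) (cycle_mins \<beta> \<tau>)))"

text \<open>A cycle is encoded as an open path; appending its starting vertex closes it. A single
  vertex yields the empty product.\<close>

fun path_prod :: "quat^'n^'n \<Rightarrow> 'n list \<Rightarrow> quat" where
  "path_prod B (x # y # zs) = B $ x $ y * path_prod B (y # zs)"
| "path_prod B _ = 1"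

definition paths :: "'n \<Rightarrow> 'n set \<Rightarrow> 'n list set" where
  "paths k \<beta> = {c. c \<noteq> [] \<and> hd c = k \<and> distinct c \<and> set c \<subseteq> \<beta>}"

lemma finite_paths [simp]: "finite (paths k \<beta> :: 'n::finite list set)"
proof (rule finite_subset)
  show "paths k \<beta> \<subseteq> {c. set c \<subseteq> UNIV \<and> distinct c}"
    by (auto simp: paths_def)
  show "finite {c :: 'n list. set c \<subseteq> UNIV \<and> distinct c}"
    by (rule finite_subset_distinct) simp
qed

lemma paths_card:
  fixes c :: "'n::finite list"
  assumes "c \<in> paths k \<beta>"
  shows "length c > 0" "card \<beta> = length c + card (\<beta> - set c)"
proof -
  have "length c = card (set c)" "set c \<subseteq> \<beta>"
    using assms by (auto simp: paths_def distinct_card)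
  then show "card \<beta> = length c + card (\<beta> - set c)"
    by (metis card_Diff_subset card_mono finite le_add_diff_inverse)
  show "length c > 0" using assms by (simp add: paths_def)
qed

lemma path_prod_append:
  "path_prod B (xs @ a # ys) = path_prod B (xs @ [a]) * path_prod B (a # ys)"
proof (induction xs rule: induct_list012)
  case (2 x)
  then show ?case by simp
qed (simp_all add: mult.assoc)

lemma path_prod_upt:
  "path_prod B (map f [0..<n] @ [f n]) = prod_list (map (\<lambda>i. B $ f i $ f (Suc i)) [0..<n])"
proof (induction n)
  case (Suc n)
  show ?case
    using path_prod_append[of B "map f [0..<n]" "f n" "[f (Suc n)]"] Suc by simp
qed simp

lemma support_eqI:
  assumes c: "c \<noteq> []" "distinct c" "hd c = j"
    and f: "\<And>i. i < length c \<Longrightarrow> f (c ! i) = c ! (Suc i mod length c)"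
  shows "support f j = c"
proof -
  have pow: "(f ^^ i) j = c ! (i mod length c)" for i
  proof (induction i)
    case 0
    then show ?case using c by (simp add: hd_conv_nth)
  next
    case (Suc i)
    then show ?case using f[of "i mod length c"] c by (simp add: mod_Suc_eq)
  qed
  have "least_power f j = length c"
    unfolding least_power_def
  proof (rule Least_equality)
    show "(f ^^ length c) j = j \<and> 0 < length c"
      using c by (simp add: pow hd_conv_nth)
  next
    fix n assume n: "(f ^^ n) j = j \<and> 0 < n"
    then have "c ! (n mod length c) = c ! 0" using c by (simp add: pow hd_conv_nth)
    then have "n mod length c = 0" using c by (simp add: nth_eq_iff_index_eq)
    then show "length c \<le> n" using n by (simp add: dvd_imp_le mod_eq_0_iff_dvd)
  qed
  then show ?thesis by (intro nth_equalityI) (simp_all add: pow)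
qed

lemma support_cong:
  assumes "\<And>i. (f ^^ i) s = (g ^^ i) s"
  shows "support f s = support g s"
  using assms by (simp add: least_power_def)

section \<open>Splitting off the cycle through a fixed element\<close>

context
  fixes \<beta> :: "'n::{finite,linorder} set" and j :: 'n and \<tau> :: "'n \<Rightarrow> 'n"
  assumes \<tau>: "\<tau> permutes \<beta>" and j: "j \<in> \<beta>"
begin

definition remove_cycle :: "'n \<Rightarrow> 'n" where
  "remove_cycle = (\<lambda>x. if x \<in> \<beta> - set (support \<tau> j) then \<tau> x else x)"

lemma permutation_of_permutes: "permutation \<tau>"
  using \<tau> by (auto simp: permutation_permutes)

lemma support_in_paths: "support \<tau> j \<in> paths j \<beta>"
proof -
  have "least_power \<tau> j > 0" using least_power_of_permutation(2)[OF permutation_of_permutes] .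
  moreover have "(\<tau> ^^ i) j \<in> \<beta>" for i
    using permutes_in_image[OF permutes_funpow[OF \<tau>]] j by blast
  ultimately show ?thesis
    using cycle_of_permutation[OF permutation_of_permutes, of j] by (auto simp: paths_def hd_map)
qed

lemma remove_cycle_permutes: "remove_cycle permutes (\<beta> - set (support \<tau> j))"
  unfolding remove_cycle_def using semidecomposition[OF \<tau>, of j] by simp

text \<open>Different cycles have disjoint supports, so an orbit starting outside the cycle through
  \<open>j\<close> never enters it.\<close>

lemma orbit_remove_cycle:
  assumes s: "s \<in> \<beta> - set (support \<tau> j)"
  shows "(\<tau> ^^ i) s \<in> \<beta> - set (support \<tau> j)" "(remove_cycle ^^ i) s = (\<tau> ^^ i) s"
proof -
  have 1: "(\<tau> ^^ i) s \<in> \<beta> - set (support \<tau> j)" for i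
  proof -
    have "set (support \<tau> s) \<inter> set (support \<tau> j) = {}"
      using disjoint_support'[OF permutation_of_permutes] s by blast
    moreover have "(\<tau> ^^ i) s \<in> set (support \<tau> s)"
      unfolding support_set[OF permutation_of_permutes] by blast
    ultimately show ?thesis
      using permutes_in_image[OF permutes_funpow[OF \<tau>]] s by blast
  qed
  then show "(\<tau> ^^ i) s \<in> \<beta> - set (support \<tau> j)" .
  show "(remove_cycle ^^ i) s = (\<tau> ^^ i) s"
    by (induction i) (use 1 in \<open>auto simp: remove_cycle_def\<close>)
qed

lemma support_remove_cycle:
  assumes "s \<in> \<beta> - set (support \<tau> j)"
  shows "support remove_cycle s = support \<tau> s"
  by (rule support_cong) (use orbit_remove_cycle(2)[OF assms] in auto)

lemma cycle_prod_remove_cycle: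
  assumes "s \<in> \<beta> - set (support \<tau> j)"
  shows "cycle_prod B remove_cycle s = cycle_prod B \<tau> s"
proof -
  have "remove_cycle t = \<tau> t" if "t \<in> set (support \<tau> s)" for t
    proof -
      obtain i where "t = (\<tau> ^^ i) s" using \<open>t \<in> set (support \<tau> s)\<close> by auto
      then show ?thesis using orbit_remove_cycle(1)[OF assms, of i] by (simp only: remove_cycle_def if_True)
    qed
  then have "map (\<lambda>t. B $ t $ remove_cycle t) (support \<tau> s) = map (\<lambda>t. B $ t $ \<tau> t) (support \<tau> s)"
    by (intro map_cong refl) (simp only:)
  then show ?thesis
    unfolding cycle_prod_def support_remove_cycle[OF assms] by (rule arg_cong)
qed

lemma cycle_ends_remove_cycle:
  "cycle_ends \<beta> j \<tau> = cycle_mins (\<beta> - set (support \<tau> j)) remove_cycle @ [j]"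
proof -
  have "{s \<in> \<beta>. s \<notin> set (support \<tau> j) \<and> (\<forall>t \<in> set (support \<tau> s). s \<le> t)} =
        {s \<in> \<beta> - set (support \<tau> j). \<forall>t \<in> set (support remove_cycle s). s \<le> t}"
  proof (rule Collect_cong)
    fix s
    have "set (support remove_cycle s) = set (support \<tau> s)" if "s \<in> \<beta> - set (support \<tau> j)"
      using support_remove_cycle[OF that] by (rule arg_cong)
    then show "(s \<in> \<beta> \<and> s \<notin> set (support \<tau> j) \<and> (\<forall>t \<in> set (support \<tau> s). s \<le> t)) =
        (s \<in> \<beta> - set (support \<tau> j) \<and> (\<forall>t \<in> set (support remove_cycle s). s \<le> t))"
      by (cases "s \<in> \<beta> - set (support \<tau> j)") blast+
  qed
  then show ?thesis unfolding cycle_ends_def cycle_mins_def by simp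
qed

lemma cycle_prod_path: "cycle_prod B \<tau> j = path_prod B (support \<tau> j @ [j])"
  using path_prod_upt[of B "\<lambda>i. (\<tau> ^^ i) j" "least_power \<tau> j"]
    least_power_of_permutation(1)[OF permutation_of_permutes, of j]
  by (simp add: cycle_prod_def comp_def)

end

lemma cycle_mins_length: "length (cycle_mins \<beta> \<tau>) \<le> card \<beta>"
  unfolding cycle_mins_def by (auto intro: card_mono)

lemma cycle_mins_subset: "set (cycle_mins \<beta> \<tau>) \<subseteq> \<beta>"
  unfolding cycle_mins_def by auto

text \<open>The inverse of splitting off a cycle. The two factors move disjoint sets, so the orbit
  of \<open>j\<close> runs exactly through \<open>c\<close>, and restricting to the complement gives
  back \<open>\<sigma>\<close>.\<close>

lemma glue_permutes:
  fixes \<beta> :: "'n::{finite,linorder} set"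
  assumes c: "c \<in> paths j \<beta>" and \<sigma>: "\<sigma> permutes (\<beta> - set c)"
  defines "\<tau> \<equiv> \<lambda>x. if x \<in> set c then cycle_of_list c x else \<sigma> x"
  shows "\<tau> permutes \<beta>" and "support \<tau> j = c"
    and "(\<lambda>x. if x \<in> \<beta> - set (support \<tau> j) then \<tau> x else x) = \<sigma>"
proof -
  have c': "c \<noteq> []" "hd c = j" "distinct c" "set c \<subseteq> \<beta>" using c by (auto simp: paths_def)
  have "\<tau> = cycle_of_list c \<circ> \<sigma>"
  proof
    fix x show "\<tau> x = (cycle_of_list c \<circ> \<sigma>) x"
    proof (cases "x \<in> set c")
      case True
      then show ?thesis using \<sigma> by (simp add: \<tau>_def permutes_def)
    next
      case False
      then have "\<sigma> x \<notin> set c"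
        using \<sigma> by (metis Diff_iff permutes_in_image permutes_not_in)
      then show ?thesis using False by (simp add: \<tau>_def id_outside_supp)
    qed
  qed
  then show "\<tau> permutes \<beta>"
    using permutes_compose[OF permutes_subset[OF \<sigma>] permutes_subset[OF cycle_permutes c'(4)]] by auto
  show s: "support \<tau> j = c"
  proof (rule support_eqI)
    fix i assume i: "i < length c"
    then have "cycle_of_list c (c ! i) = map (cycle_of_list c) c ! i" by simp
    also have "map (cycle_of_list c) c = rotate1 c"
      using cyclic_rotation[OF c'(3), of 1] by simp
    finally show "\<tau> (c ! i) = c ! (Suc i mod length c)"
      using i by (simp add: \<tau>_def nth_rotate1)
  qed (use c' in auto)
  show "(\<lambda>x. if x \<in> \<beta> - set (support \<tau> j) then \<tau> x else x) = \<sigma>"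
    unfolding s using permutes_not_in[OF \<sigma>] by (auto simp: \<tau>_def)
qed

text \<open>The sign \<open>(-1) ^ (l - 1)\<close> of a cycle of length \<open>l\<close>, with the
  exponent raised by two to avoid truncated subtraction.\<close>

definition path_sign :: "'a list \<Rightarrow> quat" where
  "path_sign c = (-1) ^ (length c + 1)"

lemma neg_one_power_shift: "a + 2 = b \<Longrightarrow> (-1) ^ a = ((-1) ^ b :: 'a::ring_1)"
  by auto

text \<open>Merging two cycles lowers their number by one. This sign change drives the cancellation
  behind Cramer's rule.\<close>

lemma path_sign_append: "path_sign (c @ d) = - (path_sign c * path_sign d)"
  by (simp add: path_sign_def power_add)

text \<open>A permutation of \<open>\<beta>\<close> amounts to a path from \<open>j\<close>, its
  cycle through \<open>j\<close>, together with a permutation of the complement. Since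
  \<open>cycle_ends\<close> lists \<open>j\<close> last, the factor of this cycle already stands
  rightmost, and no matrix entries have to be commuted.\<close>

lemma cdet_paths:
  fixes B :: "quat^('n::{finite,linorder})^('n::{finite,linorder})"
  assumes j: "j \<in> \<beta>"
  shows "cdet \<beta> j B =
    (\<Sum>c\<in>paths j \<beta>. path_sign c * mdet (\<beta> - set c) B * path_prod B (c @ [j]))"
proof -
  let ?S = "SIGMA c:paths j \<beta>. {\<sigma>. \<sigma> permutes (\<beta> - set c)}"
  let ?g = "\<lambda>c \<sigma>. (-1) ^ (card (\<beta> - set c) - length (cycle_mins (\<beta> - set c) \<sigma>)) *
     prod_list (map (cycle_prod B \<sigma>) (cycle_mins (\<beta> - set c) \<sigma>))"
  have "cdet \<beta> j B = (\<Sum>(c,\<sigma>)\<in>?S. path_sign c * ?g c \<sigma> * path_prod B (c @ [j]))"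
    unfolding cdet_def
  proof (rule sum.reindex_bij_witness[where
        j = "\<lambda>\<tau>. (support \<tau> j, \<lambda>x. if x \<in> \<beta> - set (support \<tau> j) then \<tau> x else x)" and
        i = "\<lambda>(c, \<sigma>) x. if x \<in> set c then cycle_of_list c x else \<sigma> x"])
    fix \<tau> assume "\<tau> \<in> {\<tau>. \<tau> permutes \<beta>}"
    then have \<tau>: "\<tau> permutes \<beta>" by simp
    let ?c = "support \<tau> j" and ?r = "\<lambda>x. if x \<in> \<beta> - set (support \<tau> j) then \<tau> x else x"
    note r = remove_cycle_def[OF \<tau> j]
    note c = support_in_paths[OF \<tau> j]
    show "(case (?c, ?r) of (c, \<sigma>) \<Rightarrow> \<lambda>x. if x \<in> set c then cycle_of_list c x else \<sigma> x) = \<tau>"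
    proof
      fix x
      show "(case (?c, ?r) of (c, \<sigma>) \<Rightarrow> \<lambda>x. if x \<in> set c then cycle_of_list c x else \<sigma> x) x = \<tau> x"
        using cycle_restrict[OF permutation_of_permutes[OF \<tau> j], of x j] permutes_not_in[OF \<tau>, of x] by auto
    qed
    show "(?c, ?r) \<in> ?S"
      using c remove_cycle_permutes[OF \<tau> j] by (simp add: r)
    have m: "prod_list (map (cycle_prod B ?r) (cycle_mins (\<beta> - set ?c) ?r)) =
        prod_list (map (cycle_prod B \<tau>) (cycle_mins (\<beta> - set ?c) ?r))"
      using cycle_prod_remove_cycle[OF \<tau> j] cycle_mins_subset[of "\<beta> - set ?c" ?r] unfolding r
      by (intro arg_cong[of _ _ prod_list] map_cong) auto
    note card = paths_card[OF c]
    have "length (cycle_mins (\<beta> - set ?c) ?r) \<le> card (\<beta> - set ?c)"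
      by (rule cycle_mins_length)
    \<comment> \<open>The element \<open>j\<close> counts as one more cycle end. The path is
      nonempty, so no subtraction truncates, and the two exponents differ by exactly 2.\<close>
    then have "card \<beta> - length (cycle_mins (\<beta> - set ?c) ?r @ [j]) + 2 =
        length ?c + 1 + (card (\<beta> - set ?c) - length (cycle_mins (\<beta> - set ?c) ?r))"
      using card unfolding length_append by simp
    then have sg: "(-1) ^ (card \<beta> - length (cycle_mins (\<beta> - set ?c) ?r @ [j])) =
        path_sign ?c * (-1) ^ (card (\<beta> - set ?c) - length (cycle_mins (\<beta> - set ?c) ?r))"
      unfolding path_sign_def power_add[symmetric] by (rule neg_one_power_shift)
    show "(case (?c, ?r) of (c, \<sigma>) \<Rightarrow> path_sign c * ?g c \<sigma> * path_prod B (c @ [j])) =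
        (-1) ^ (card \<beta> - length (cycle_ends \<beta> j \<tau>)) * prod_list (map (cycle_prod B \<tau>) (cycle_ends \<beta> j \<tau>))"
      unfolding cycle_ends_remove_cycle[OF \<tau> j] r sg prod.case m map_append prod_list.append
      by (simp add: cycle_prod_path[OF \<tau> j] mult.assoc)
  next
    fix p assume "p \<in> ?S"
    then obtain c \<sigma> where p: "p = (c, \<sigma>)" "c \<in> paths j \<beta>" "\<sigma> permutes (\<beta> - set c)" by auto
    note g = glue_permutes[OF p(2,3)]
    show "(case p of (c, \<sigma>) \<Rightarrow> \<lambda>x. if x \<in> set c then cycle_of_list c x else \<sigma> x) \<in> {\<tau>. \<tau> permutes \<beta>}"
      using g(1) p by simp
    show "(support (case p of (c, \<sigma>) \<Rightarrow> \<lambda>x. if x \<in> set c then cycle_of_list c x else \<sigma> x) j,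
        \<lambda>x. if x \<in> \<beta> - set (support (case p of (c, \<sigma>) \<Rightarrow> \<lambda>x. if x \<in> set c then cycle_of_list c x else \<sigma> x) j)
             then (case p of (c, \<sigma>) \<Rightarrow> \<lambda>x. if x \<in> set c then cycle_of_list c x else \<sigma> x) x else x) = p"
      using g(2,3) unfolding p(1) prod.case by (simp only:)
  qed
  also have "\<dots> = (\<Sum>c\<in>paths j \<beta>. \<Sum>\<sigma> | \<sigma> permutes (\<beta> - set c). path_sign c * ?g c \<sigma> * path_prod B (c @ [j]))"
    by (subst sum.Sigma) auto
  finally show ?thesis
    by (simp add: mdet_def sum_distrib_left sum_distrib_right)
qed

lemma mdet_empty [simp]: "mdet {} B = 1"
  by (simp add: mdet_def cycle_mins_def)

text \<open>Listing all cycles by decreasing minima already puts the cycle through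
  \<open>Min \<beta>\<close> last, so distinguishing that cycle changes nothing.\<close>

lemma mdet_eq_cdet:
  fixes B :: "quat^('n::{finite,linorder})^('n::{finite,linorder})"
  assumes "\<beta> \<noteq> {}"
  shows "mdet \<beta> B = cdet \<beta> (Min \<beta>) B"
proof -
  let ?j = "Min \<beta>"
  have j: "?j \<in> \<beta>" using assms by simp
  have "cycle_ends \<beta> ?j \<tau> = cycle_mins \<beta> \<tau>" if \<tau>: "\<tau> permutes \<beta>" for \<tau>
  proof -
    have perm: "permutation \<tau>" using permutation_of_permutes[OF \<tau> j] .
    have mem: "s \<in> set (support \<tau> s)" for s
      unfolding support_set[OF perm] by (metis funpow_0 rangeI)
    have sub: "set (support \<tau> s) \<subseteq> \<beta>" if "s \<in> \<beta>" for s
      using support_in_paths[OF \<tau> that] by (auto simp: paths_def)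
    let ?A = "{s \<in> \<beta>. \<forall>t \<in> set (support \<tau> s). s \<le> t}"
    let ?A' = "{s \<in> \<beta>. s \<notin> set (support \<tau> ?j) \<and> (\<forall>t \<in> set (support \<tau> s). s \<le> t)}"
    have eq: "?A = insert ?j ?A'"
    proof (intro equalityI subsetI)
      fix s assume s: "s \<in> ?A"
      show "s \<in> insert ?j ?A'"
      proof (cases "s \<in> set (support \<tau> ?j)")
        case True
        then have "set (support \<tau> s) \<inter> set (support \<tau> ?j) \<noteq> {}" using mem by blast
        then have "?j \<in> set (support \<tau> s)"
          using disjoint_support'[OF perm, of ?j s] by blast
        then have "s \<le> ?j" using s by blast
        moreover have "?j \<le> s" using s by simp
        ultimately have "s = ?j" by (rule antisym)
        then show ?thesis by simp
      qed (use s in auto)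
    next
      fix s assume "s \<in> insert ?j ?A'"
      then show "s \<in> ?A" using sub[OF j] j by (auto intro: Min_le)
    qed
    have "sorted_list_of_set ?A = ?j # sorted_list_of_set ?A'"
      unfolding eq
    proof (subst sorted_list_of_set.sorted_key_list_of_set_insert)
      show "?j \<notin> ?A'" using mem by auto
      have "\<forall>x\<in>?A'. ?j \<le> x" by auto
      then have "insort ?j (sorted_list_of_set ?A') = ?j # sorted_list_of_set ?A'"
        by (intro insort_is_Cons) auto
      then show "insort ?j (sorted_list_of_set ?A') = ?j # sorted_list_of_set ?A'" .
    qed auto
    then show ?thesis by (simp add: cycle_ends_def cycle_mins_def)
  qed
  then show ?thesis unfolding mdet_def cdet_def by (intro sum.cong) auto
qed

lemma mdet_cong:
  fixes B C :: "quat^('n::{finite,linorder})^('n::{finite,linorder})"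
  assumes "\<And>i j. i \<in> \<beta> \<Longrightarrow> j \<in> \<beta> \<Longrightarrow> B $ i $ j = C $ i $ j"
  shows "mdet \<beta> B = mdet \<beta> C"
proof -
  have "cycle_prod B \<tau> s = cycle_prod C \<tau> s" if \<tau>: "\<tau> permutes \<beta>" and s: "s \<in> \<beta>" for \<tau> s
    unfolding cycle_prod_def
  proof (intro arg_cong[of _ _ prod_list] map_cong refl)
    fix t assume "t \<in> set (support \<tau> s)"
    then have "t \<in> \<beta>" using support_in_paths[OF \<tau> s] by (auto simp: paths_def)
    then show "B $ t $ \<tau> t = C $ t $ \<tau> t"
      using assms permutes_in_image[OF \<tau>] by simp
  qed
  then have "map (cycle_prod B \<tau>) (cycle_mins \<beta> \<tau>) = map (cycle_prod C \<tau>) (cycle_mins \<beta> \<tau>)"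
    if "\<tau> permutes \<beta>" for \<tau>
    using that cycle_mins_subset by (intro map_cong) blast+
  then show ?thesis unfolding mdet_def by (intro sum.cong refl) (simp only: mem_Collect_eq)
qed

section \<open>Conjugation and Hermitian matrices\<close>

lemma qcnj_simps [simp]:
  "qcnj (x + y) = qcnj x + qcnj y" "qcnj (x - y) = qcnj x - qcnj y" "qcnj (- x) = - qcnj x"
  "qcnj (x * y) = qcnj y * qcnj x" "qcnj 0 = 0" "qcnj 1 = 1" "qcnj (qcnj x) = x"
  "qcnj (r *\<^sub>R x) = r *\<^sub>R qcnj x"
  by (simp_all add: quat_eq_iff algebra_simps)

lemma qcnj_sum [simp]: "qcnj (sum f S) = (\<Sum>x\<in>S. qcnj (f x))"
  by (induction S rule: infinite_finite_induct) auto

lemma qRe_sum [simp]: "qRe (sum f S) = (\<Sum>x\<in>S. qRe (f x))"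
  by (induction S rule: infinite_finite_induct) auto

lemma of_real_sel [simp]:
  "qRe (of_real r) = r" "qIm1 (of_real r) = 0" "qIm2 (of_real r) = 0" "qIm3 (of_real r) = 0"
  by (simp_all add: of_real_def)

lemma qcnj_of_real [simp]: "qcnj (of_real r) = of_real r"
  by (simp add: quat_eq_iff)

lemma Reals_iff_qcnj: "x \<in> \<real> \<longleftrightarrow> qcnj x = x"
proof
  assume "qcnj x = x"
  then have "x = of_real (qRe x)" by (simp add: quat_eq_iff)
  then show "x \<in> \<real>" by (metis Reals_of_real)
qed (auto elim: Reals_cases)

lemma of_real_qRe: "x \<in> \<real> \<Longrightarrow> of_real (qRe x) = x"
  by (auto elim: Reals_cases)

lemma Reals_central: "x \<in> \<real> \<Longrightarrow> x * y = y * x" for x y :: quat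
  by (auto elim!: Reals_cases simp: quat_eq_iff)

lemma qRe_mult_commute: "qRe (x * y) = qRe (y * x)"
  by simp

lemma qRe_mult_Reals: "x \<in> \<real> \<Longrightarrow> qRe (x * y) = qRe x * qRe y"
  by (auto elim!: Reals_cases)

lemma path_sign_Reals: "path_sign c \<in> \<real>"
  by (simp add: path_sign_def)

lemma hermitian_nth: "hermitian B \<Longrightarrow> qcnj (B $ i $ j) = B $ j $ i"
  unfolding hermitian_def adj_def by (metis vec_lambda_beta)

lemma path_prod_rev:
  assumes "hermitian B"
  shows "path_prod B (rev c) = qcnj (path_prod B c)"
proof (induction c rule: induct_list012)
  case (3 x y zs)
  then show ?case
    using path_prod_append[of B "rev zs" y "[x]"] hermitian_nth[OF assms] by simp
qed simp_all

text \<open>Traversing the cycle through \<open>k\<close> backwards permutes the summands and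
  conjugates each of them, because the minors of the complements are real by assumption.\<close>

lemma hermitian_cdet_Reals:
  fixes B :: "quat^('n::{finite,linorder})^('n::{finite,linorder})"
  assumes B: "hermitian B" and k: "k \<in> \<beta>"
    and R: "\<And>\<gamma>. \<gamma> \<subset> \<beta> \<Longrightarrow> mdet \<gamma> B \<in> \<real>"
  shows "cdet \<beta> k B \<in> \<real>"
proof -
  \<comment> \<open>The start is kept and the rest reversed, so that the closed path
    \<open>c @ [k]\<close> is reversed as a whole.\<close>
  define rv :: "'n list \<Rightarrow> 'n list" where "rv c = hd c # rev (tl c)" for c
  have rv: "rv (rv c) = c" "rv c \<in> paths k \<beta>" "set (rv c) = set c" "length (rv c) = length c"
      "rv c @ [k] = rev (c @ [k])"
    if "c \<in> paths k \<beta>" for c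
    using that by (cases c; auto simp: rv_def paths_def)+
  have "qcnj (cdet \<beta> k B) =
      (\<Sum>c\<in>paths k \<beta>. path_sign c * mdet (\<beta> - set c) B * path_prod B (rv c @ [k]))"
    unfolding cdet_paths[OF k] qcnj_sum
  proof (rule sum.cong[OF refl])
    fix c assume c: "c \<in> paths k \<beta>"
    have "\<beta> - set c \<subset> \<beta>" using c k by (cases c) (auto simp: paths_def)
    then have "path_sign c * mdet (\<beta> - set c) B \<in> \<real>"
      using R path_sign_Reals by (intro Reals_mult) auto
    then show "qcnj (path_sign c * mdet (\<beta> - set c) B * path_prod B (c @ [k])) =
        path_sign c * mdet (\<beta> - set c) B * path_prod B (rv c @ [k])"
      unfolding rv(5)[OF c] path_prod_rev[OF B] qcnj_simps(4)[of "path_sign c * mdet (\<beta> - set c) B"]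
      by (metis Reals_central Reals_iff_qcnj)
  qed
  also have "\<dots> = (\<Sum>c\<in>paths k \<beta>. path_sign c * mdet (\<beta> - set c) B * path_prod B (c @ [k]))"
    by (rule sum.reindex_bij_witness[where i = rv and j = rv]) (use rv in \<open>auto simp: path_sign_def\<close>)
  finally show ?thesis unfolding Reals_iff_qcnj cdet_paths[OF k] .
qed

lemma split_at_first:
  assumes "i \<notin> set xs"
  shows "takeWhile (\<lambda>x. x \<noteq> i) (xs @ i # ys) = xs" "dropWhile (\<lambda>x. x \<noteq> i) (xs @ i # ys) = i # ys"
  using assms by (induction xs) auto

text \<open>A cycle through both \<open>i\<close> and \<open>k\<close> may be started at either
  vertex. Rotation keeps its length and vertex set and only permutes the product cyclically, which
  the real part does not notice.\<close>

lemma sum_paths_through: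
  fixes B :: "quat^'n^'n" and g :: "'n set \<Rightarrow> real"
  assumes "i \<noteq> k"
  shows "(\<Sum>c | c \<in> paths k \<beta> \<and> i \<in> set c. (-1) ^ (length c + 1) * g (set c) * qRe (path_prod B (c @ [k]))) =
    (\<Sum>c | c \<in> paths i \<beta> \<and> k \<in> set c. (-1) ^ (length c + 1) * g (set c) * qRe (path_prod B (c @ [i])))"
proof -
  define rot where "rot i c = dropWhile (\<lambda>x. x \<noteq> i) c @ takeWhile (\<lambda>x. x \<noteq> i) c" for i :: 'n and c
  have rot: "rot k (rot i c) = c \<and> rot i c \<in> paths i \<beta> \<and> k \<in> set (rot i c) \<and> set (rot i c) = set c \<and>
      length (rot i c) = length c \<and>
      qRe (path_prod B (rot i c @ [i])) = qRe (path_prod B (c @ [k]))"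
    if c: "c \<in> paths k \<beta>" "i \<in> set c" and ik: "i \<noteq> k" for c i k
  proof -
    obtain as bs where ab: "c = as @ i # bs" "i \<notin> set as" using c(2) by (metis split_list_first)
    have "as \<noteq> []" using ab c ik by (auto simp: paths_def)
    then obtain as' where as: "as = k # as'" using ab c by (cases as) (auto simp: paths_def)
    have r: "rot i c = i # bs @ k # as'"
      unfolding rot_def ab(1) split_at_first[OF ab(2)] using as by simp
    have "k \<notin> set (i # bs)" using c(1) ik unfolding ab(1) as by (auto simp: paths_def)
    then have "rot k ((i # bs) @ k # as') = (k # as') @ i # bs"
      unfolding rot_def using split_at_first[of k "i # bs" as'] by (simp only: not_False_eq_True)
    then have "rot k (rot i c) = c" unfolding r using ab(1) as by simp
    moreover have "qRe (path_prod B (rot i c @ [i])) = qRe (path_prod B (c @ [k]))"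
      \<comment> \<open>Both closed paths consist of the same two arcs, from \<open>k\<close> to
        \<open>i\<close> and from \<open>i\<close> to \<open>k\<close>, multiplied in opposite
        orders.\<close>
      using path_prod_append[of B "i # bs" k "as' @ [i]"] path_prod_append[of B "k # as'" i "bs @ [k]"]
        qRe_mult_commute[of "path_prod B (i # bs @ [k])" "path_prod B (k # as' @ [i])"]
      unfolding r unfolding ab(1) as by (simp del: times_quat.sel)
    ultimately show ?thesis
      using c(1) unfolding r unfolding ab(1) as by (auto simp: paths_def)
  qed
  show ?thesis
    by (rule sum.reindex_bij_witness[where i = "rot k" and j = "rot i"])
      (use rot[OF _ _ assms] rot[OF _ _ assms[symmetric]] in auto)
qed

text \<open>Both sides range over the pairs of disjoint paths, one from \<open>k\<close> and one
  from \<open>i\<close>; only the order of choice differs.\<close>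

lemma sum_disjoint_paths_swap:
  fixes h :: "'n::finite list \<Rightarrow> 'n list \<Rightarrow> real"
  assumes "k \<in> \<beta>" "i \<in> \<beta>"
  shows "(\<Sum>c | c \<in> paths k \<beta> \<and> i \<notin> set c. \<Sum>d\<in>paths i (\<beta> - set c). h c d) =
    (\<Sum>d | d \<in> paths i \<beta> \<and> k \<notin> set d. \<Sum>c\<in>paths k (\<beta> - set d). h c d)"
proof -
  have *: "c \<noteq> [] \<Longrightarrow> hd c \<in> set c" for c :: "'n list" by simp
  have "(\<Sum>c | c \<in> paths k \<beta> \<and> i \<notin> set c. \<Sum>d\<in>paths i (\<beta> - set c). h c d) =
      (\<Sum>(c,d)\<in>(SIGMA c:{c. c \<in> paths k \<beta> \<and> i \<notin> set c}. paths i (\<beta> - set c)). h c d)"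
    by (subst sum.Sigma) auto
  also have "\<dots> = (\<Sum>(d,c)\<in>(SIGMA d:{d. d \<in> paths i \<beta> \<and> k \<notin> set d}. paths k (\<beta> - set d)). h c d)"
    by (rule sum.reindex_bij_witness[where i = prod.swap and j = prod.swap])
      (use * in \<open>force simp: paths_def\<close>)+
  also have "\<dots> = (\<Sum>d | d \<in> paths i \<beta> \<and> k \<notin> set d. \<Sum>c\<in>paths k (\<beta> - set d). h c d)"
    by (subst sum.Sigma) auto
  finally show ?thesis .
qed

text \<open>Induction on the size of \<open>\<beta>\<close>. Smaller minors are real, so real parts
  expand with commuting real weights. To compare columns \<open>k\<close> and \<open>i\<close>,
  cycles through both are rotated, while disjoint cycles through \<open>k\<close> and through
  \<open>i\<close> enter symmetrically. Equal real parts suffice because the column determinants are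
  real.\<close>

lemma hermitian_cdet_mdet:
  fixes B :: "quat^('n::{finite,linorder})^('n::{finite,linorder})"
  assumes B: "hermitian B"
  shows "mdet \<beta> B \<in> \<real> \<and> (\<forall>k\<in>\<beta>. cdet \<beta> k B = mdet \<beta> B)"
proof (induction "card \<beta>" arbitrary: \<beta> rule: less_induct)
  case less
  have IH: "mdet \<gamma> B \<in> \<real>" "k \<in> \<gamma> \<Longrightarrow> cdet \<gamma> k B = mdet \<gamma> B" if "\<gamma> \<subset> \<beta>" for \<gamma> k
    using less psubset_card_mono[OF _ that] by auto
  define d where "d \<gamma> = qRe (mdet \<gamma> B)" for \<gamma>
  define a where "a c = (-1) ^ (length c + 1) * qRe (path_prod B (c @ [hd c]))" for c
  have sub: "\<beta> - set c \<subset> \<beta>" if "c \<in> paths k \<beta>" for c k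
    using that by (cases c) (auto simp: paths_def)
  have sgn: "qRe (path_sign c) = (-1) ^ (length c + 1)" for c :: "'n list"
    by (cases "even (length c)") (simp_all add: path_sign_def)
  have expand: "qRe (cdet \<gamma> k B) = (\<Sum>c\<in>paths k \<gamma>. a c * d (\<gamma> - set c))"
    if "\<gamma> \<subseteq> \<beta>" "k \<in> \<gamma>" for \<gamma> k
    unfolding cdet_paths[OF that(2)] qRe_sum
  proof (rule sum.cong[OF refl])
    fix c assume c: "c \<in> paths k \<gamma>"
    have "\<gamma> - set c \<subset> \<beta>" using c that by (cases c) (auto simp: paths_def)
    then have "mdet (\<gamma> - set c) B \<in> \<real>" by (rule IH)
    moreover have "hd c = k" using c by (simp add: paths_def)
    ultimately show "qRe (path_sign c * mdet (\<gamma> - set c) B * path_prod B (c @ [k])) = a c * d (\<gamma> - set c)"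
      using path_sign_Reals[of c]
      by (simp add: qRe_mult_Reals sgn a_def d_def del: times_quat.sel)
  qed
  have real: "cdet \<beta> k B \<in> \<real>" if "k \<in> \<beta>" for k
    by (rule hermitian_cdet_Reals[OF B that IH(1)])
  \<comment> \<open>If the cycle through \<open>k\<close> misses \<open>i\<close>, the minor of its
    complement is expanded once more, along column \<open>i\<close>.\<close>
  have split: "qRe (cdet \<beta> k B) = (\<Sum>c | c \<in> paths k \<beta> \<and> i \<in> set c. a c * d (\<beta> - set c)) +
      (\<Sum>c | c \<in> paths k \<beta> \<and> i \<notin> set c. \<Sum>c'\<in>paths i (\<beta> - set c). a c * a c' * d (\<beta> - set c - set c'))"
    if "k \<in> \<beta>" "i \<in> \<beta>" for i k
  proof -
    have "qRe (cdet \<beta> k B) = (\<Sum>c | c \<in> paths k \<beta> \<and> i \<in> set c. a c * d (\<beta> - set c)) +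
      (\<Sum>c | c \<in> paths k \<beta> \<and> i \<notin> set c. a c * d (\<beta> - set c))"
      unfolding expand[OF order.refl that(1)]
      by (subst sum.union_disjoint[symmetric]) (auto intro: sum.cong)
    moreover have "a c * d (\<beta> - set c) =
        (\<Sum>c'\<in>paths i (\<beta> - set c). a c * a c' * d (\<beta> - set c - set c'))"
      if c: "c \<in> paths k \<beta>" "i \<notin> set c" for c
    proof -
      have "d (\<beta> - set c) = qRe (cdet (\<beta> - set c) i B)"
        using IH(2)[OF sub[OF c(1)], of i] c \<open>i \<in> \<beta>\<close> by (simp add: d_def)
      also have "\<dots> = (\<Sum>c'\<in>paths i (\<beta> - set c). a c' * d (\<beta> - set c - set c'))"
        using expand[of "\<beta> - set c" i] c \<open>i \<in> \<beta>\<close> by simp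
      finally show ?thesis by (simp add: sum_distrib_left mult.assoc)
    qed
    ultimately show ?thesis by simp
  qed
  have indep: "qRe (cdet \<beta> k B) = qRe (cdet \<beta> i B)" if "k \<in> \<beta>" "i \<in> \<beta>" for i k
  proof (cases "i = k")
    case False
    have "(\<Sum>c | c \<in> paths k \<beta> \<and> i \<in> set c. a c * d (\<beta> - set c)) =
        (\<Sum>c | c \<in> paths i \<beta> \<and> k \<in> set c. a c * d (\<beta> - set c))"
      using sum_paths_through[OF False, where \<beta> = \<beta> and g = "\<lambda>S. d (\<beta> - S)" and B = B]
      by (auto simp: a_def paths_def mult_ac intro: sum.cong)
    moreover have "(\<Sum>c | c \<in> paths k \<beta> \<and> i \<notin> set c. \<Sum>c'\<in>paths i (\<beta> - set c). a c * a c' * d (\<beta> - set c - set c')) =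
      (\<Sum>c | c \<in> paths i \<beta> \<and> k \<notin> set c. \<Sum>c'\<in>paths k (\<beta> - set c). a c * a c' * d (\<beta> - set c - set c'))"
      unfolding sum_disjoint_paths_swap[OF that]
      by (intro sum.cong refl) (simp add: mult_ac Diff_eq Int_ac)
    ultimately show ?thesis unfolding split[OF that] split[OF that(2,1)] by simp
  qed simp
  have "cdet \<beta> k B = mdet \<beta> B" if "k \<in> \<beta>" for k
    using mdet_eq_cdet[of \<beta> B] indep[OF that, of "Min \<beta>"] that real
    by (metis Min_in empty_iff finite of_real_qRe)
  moreover have "mdet \<beta> B \<in> \<real>"
    using mdet_eq_cdet[of \<beta> B] real[of "Min \<beta>"] by (cases "\<beta> = {}") simp_all
  ultimately show ?case by blast
qed

text \<open>An element of \<open>\<beta>\<close> is what makes the defining condition of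
  \<open>hdet\<close> single out one real number.\<close>

lemma hdet_eq:
  fixes B :: "quat^('n::{finite,linorder})^('n::{finite,linorder})"
  assumes "hermitian B" "\<beta> \<noteq> {}"
  shows "hdet \<beta> B = qRe (mdet \<beta> B)"
proof -
  note m = hermitian_cdet_mdet[OF assms(1), of \<beta>]
  obtain j where "j \<in> \<beta>" using assms(2) by blast
  show ?thesis unfolding hdet_def
  proof (rule the_equality)
    show "\<forall>j\<in>\<beta>. cdet \<beta> j B = of_real (qRe (mdet \<beta> B))"
      using m by (simp add: of_real_qRe)
    fix d assume "\<forall>j\<in>\<beta>. cdet \<beta> j B = of_real d"
    then show "d = qRe (mdet \<beta> B)" using m \<open>j \<in> \<beta>\<close> by (metis of_real_sel(1))
  qed
qed

section \<open>Cofactors and Cramer's rule\<close>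

text \<open>What remains of the expansion along column \<open>k\<close> when the closing edge from
  \<open>i\<close> back to \<open>k\<close> is deleted: the left coefficient of the entry in row
  \<open>i\<close> of column \<open>k\<close>.\<close>

definition cof :: "('n::{finite,linorder}) set \<Rightarrow> quat^('n::{finite,linorder})^('n::{finite,linorder}) \<Rightarrow> 'n \<Rightarrow> 'n \<Rightarrow> quat" where
  "cof \<beta> B k i = (\<Sum>c | c \<in> paths k \<beta> \<and> last c = i. path_sign c * mdet (\<beta> - set c) B * path_prod B c)"

lemma cof_outside: "i \<notin> \<beta> \<Longrightarrow> cof \<beta> B k i = 0"
proof -
  assume "i \<notin> \<beta>"
  then have "{c. c \<in> paths k \<beta> \<and> last c = i} = {}"
    using last_in_set by (fastforce simp: paths_def)
  then show ?thesis unfolding cof_def by (simp only: sum.empty)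
qed

lemma sum_cof:
  "(\<Sum>i\<in>UNIV. cof \<beta> B k i * g i) =
    (\<Sum>c\<in>paths k \<beta>. path_sign c * mdet (\<beta> - set c) B * (path_prod B c * g (last c)))"
proof -
  have "(\<Sum>i\<in>UNIV. cof \<beta> B k i * g i) = (\<Sum>i\<in>UNIV. \<Sum>c | c \<in> paths k \<beta> \<and> last c = i.
      path_sign c * mdet (\<beta> - set c) B * (path_prod B c * g (last c)))"
    unfolding cof_def sum_distrib_right by (intro sum.cong refl) (auto simp: mult.assoc)
  also have "\<dots> = (\<Sum>c\<in>paths k \<beta>. path_sign c * mdet (\<beta> - set c) B * (path_prod B c * g (last c)))"
    by (rule sum.group) auto
  finally show ?thesis .
qed

lemma path_prod_snoc:
  assumes "c \<noteq> []"
  shows "path_prod B (c @ [l]) = path_prod B c * B $ last c $ l"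
  using assms path_prod_append[of B _ _ "[l]"] by (cases c rule: rev_cases) auto

lemma sum_cof_column:
  "(\<Sum>i\<in>UNIV. cof \<beta> B k i * B $ i $ l) =
    (\<Sum>c\<in>paths k \<beta>. path_sign c * mdet (\<beta> - set c) B * path_prod B (c @ [l]))"
  unfolding sum_cof by (intro sum.cong refl) (auto simp: paths_def path_prod_snoc)

lemma path_prod_cong:
  assumes "\<And>i j. j \<in> set (tl c) \<Longrightarrow> B $ i $ j = C $ i $ j"
  shows "path_prod B c = path_prod C c"
  using assms by (induction c rule: induct_list012) auto

text \<open>A path from \<open>k\<close> does not return to \<open>k\<close>, and the complement of
  its vertices does not contain \<open>k\<close>. Column \<open>k\<close> therefore enters only
  through the closing edge.\<close>

lemma cdet_replace_col:
  assumes "k \<in> \<beta>"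
  shows "cdet \<beta> k (replace_col B k v) = (\<Sum>i\<in>UNIV. cof \<beta> B k i * v $ i)"
  unfolding cdet_paths[OF assms] sum_cof
proof (rule sum.cong[OF refl])
  fix c assume "c \<in> paths k \<beta>"
  then obtain d where d: "c = k # d" "k \<notin> set d" by (cases c) (auto simp: paths_def)
  let ?R = "replace_col B k v"
  have "mdet (\<beta> - set c) ?R = mdet (\<beta> - set c) B"
    by (rule mdet_cong) (use d in \<open>auto simp: replace_col_def\<close>)
  moreover have "path_prod ?R c = path_prod B c"
    by (rule path_prod_cong) (use d in \<open>auto simp: replace_col_def\<close>)
  ultimately show "path_sign c * mdet (\<beta> - set c) ?R * path_prod ?R (c @ [k]) =
      path_sign c * mdet (\<beta> - set c) B * (path_prod B c * v $ last c)"
    using d path_prod_snoc[of c ?R k] by (simp add: replace_col_def)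
qed

lemma Diff_Un_left: "A - (B \<union> C) = A - B - C"
  by auto

text \<open>
  For \<open>l \<noteq> k\<close> the sum cancels: a path from \<open>k\<close> avoiding \<open>l\<close> together with a cycle through
  \<open>l\<close> in its complement contributes the opposite of the path obtained by concatenation.
\<close>

lemma cof_mult_column:
  fixes B :: "quat^('n::{finite,linorder})^('n::{finite,linorder})"
  assumes B: "hermitian B" and k: "k \<in> \<beta>" and l: "l \<in> \<beta>"
  shows "(\<Sum>i\<in>UNIV. cof \<beta> B k i * B $ i $ l) = (if l = k then mdet \<beta> B else 0)"
proof (cases "l = k")
  case True
  then show ?thesis
    using hermitian_cdet_mdet[OF B, of \<beta>] k cdet_paths[OF k, of B] unfolding sum_cof_column by simp
next
  case False
  define T where "T c = path_sign c * mdet (\<beta> - set c) B * path_prod B (c @ [l])" for c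
  let ?A = "{c. c \<in> paths k \<beta> \<and> l \<notin> set c}"
  let ?S = "SIGMA c:?A. paths l (\<beta> - set c)"
  note real = hermitian_cdet_mdet[OF B, THEN conjunct1]
  have "(\<Sum>c\<in>?A. T c) = (\<Sum>c\<in>?A. \<Sum>d\<in>paths l (\<beta> - set c). - T (c @ d))"
  proof (rule sum.cong[OF refl])
    fix c assume c: "c \<in> ?A"
    \<comment> \<open>The real minor is moved to the right end, so that the cycle from its expansion
      along \<open>l\<close> directly continues the path closed at \<open>l\<close>.\<close>
    have "T c = path_sign c * path_prod B (c @ [l]) * mdet (\<beta> - set c) B"
      unfolding T_def mult.assoc Reals_central[OF real] ..
    also have "mdet (\<beta> - set c) B = cdet (\<beta> - set c) l B"
      using hermitian_cdet_mdet[OF B, of "\<beta> - set c"] c l by auto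
    also have "\<dots> = (\<Sum>d\<in>paths l (\<beta> - set c). path_sign d * mdet (\<beta> - set c - set d) B * path_prod B (d @ [l]))"
      using c l by (intro cdet_paths) auto
    also have "path_sign c * path_prod B (c @ [l]) * \<dots> = (\<Sum>d\<in>paths l (\<beta> - set c). - T (c @ d))"
      unfolding sum_distrib_left
    proof (rule sum.cong[OF refl])
      fix d assume "d \<in> paths l (\<beta> - set c)"
      then obtain e where "d = l # e" by (cases d) (auto simp: paths_def)
      then have p: "path_prod B ((c @ d) @ [l]) = path_prod B (c @ [l]) * path_prod B (d @ [l])"
        using path_prod_append[of B c l "e @ [l]"] by simp
      have "path_sign d * mdet (\<beta> - set c - set d) B \<in> \<real>"
        using real path_sign_Reals by (rule Reals_mult[rotated])
      from Reals_central[OF this, of "path_prod B (c @ [l])"]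
      have "path_sign c * path_prod B (c @ [l]) *
          (path_sign d * mdet (\<beta> - set c - set d) B * path_prod B (d @ [l])) =
          path_sign c * (path_sign d * mdet (\<beta> - set c - set d) B * path_prod B (c @ [l])) * path_prod B (d @ [l])"
        by (simp only: mult.assoc)
      also have "\<dots> = - T (c @ d)"
        unfolding T_def path_sign_append p set_append Diff_Un_left by (simp add: mult.assoc)
      finally show "path_sign c * path_prod B (c @ [l]) *
          (path_sign d * mdet (\<beta> - set c - set d) B * path_prod B (d @ [l])) = - T (c @ d)" .
    qed
    finally show "T c = (\<Sum>d\<in>paths l (\<beta> - set c). - T (c @ d))" .
  qed
  also have "\<dots> = (\<Sum>(c,d)\<in>?S. - T (c @ d))"
    by (subst sum.Sigma) auto
  also have "\<dots> = - (\<Sum>(c,d)\<in>?S. T (c @ d))"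
    unfolding sum_negf[symmetric] by (intro sum.cong) auto
  also have "(\<Sum>(c,d)\<in>?S. T (c @ d)) = (\<Sum>c | c \<in> paths k \<beta> \<and> l \<in> set c. T c)"
  \<comment> \<open>Cutting a path just before \<open>l\<close> recovers the two pieces.\<close>
  proof (rule sum.reindex_bij_witness[where j = "\<lambda>(c,d). c @ d" and
        i = "\<lambda>c. (takeWhile (\<lambda>x. x \<noteq> l) c, dropWhile (\<lambda>x. x \<noteq> l) c)"])
    fix p assume "p \<in> ?S"
    then obtain c d where p: "p = (c, d)" "c \<in> paths k \<beta>" "l \<notin> set c" "d \<in> paths l (\<beta> - set c)" by auto
    then obtain e where e: "d = l # e" by (cases d) (auto simp: paths_def)
    show "(takeWhile (\<lambda>x. x \<noteq> l) (case p of (c, d) \<Rightarrow> c @ d), dropWhile (\<lambda>x. x \<noteq> l) (case p of (c, d) \<Rightarrow> c @ d)) = p"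
      unfolding p(1) prod.case e split_at_first[OF p(3)] ..
    show "(case p of (c, d) \<Rightarrow> c @ d) \<in> {c. c \<in> paths k \<beta> \<and> l \<in> set c}"
      using p e by (auto simp: paths_def)
    show "T (case p of (c, d) \<Rightarrow> c @ d) = (case p of (c, d) \<Rightarrow> T (c @ d))"
      by (simp add: p)
  next
    fix c assume "c \<in> {c. c \<in> paths k \<beta> \<and> l \<in> set c}"
    then have c: "c \<in> paths k \<beta>" "l \<in> set c" by auto
    obtain as bs where ab: "c = as @ l # bs" "l \<notin> set as" using c(2) by (metis split_list_first)
    have "as \<noteq> []" using ab c False by (auto simp: paths_def)
    then show "(takeWhile (\<lambda>x. x \<noteq> l) c, dropWhile (\<lambda>x. x \<noteq> l) c) \<in> ?S"
      using c unfolding ab(1) split_at_first[OF ab(2)] by (auto simp: paths_def ab(2))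
    show "(case (takeWhile (\<lambda>x. x \<noteq> l) c, dropWhile (\<lambda>x. x \<noteq> l) c) of (c, d) \<Rightarrow> c @ d) = c"
      by simp
  qed
  finally have "(\<Sum>c\<in>?A. T c) + (\<Sum>c | c \<in> paths k \<beta> \<and> l \<in> set c. T c) = 0" by simp
  moreover have "(\<Sum>c\<in>paths k \<beta>. T c) = (\<Sum>c\<in>?A. T c) + (\<Sum>c | c \<in> paths k \<beta> \<and> l \<in> set c. T c)"
    by (subst sum.union_disjoint[symmetric]) (auto intro: sum.cong)
  ultimately show ?thesis using False unfolding sum_cof_column T_def by simp
qed

text \<open>Dropping the final vertex \<open>l\<close> leaves a path inside \<open>\<beta>\<close>
  with the same complement; one vertex less flips the sign. This covers the columns outside
  \<open>\<beta>\<close>, which Cramer's rule does not reach.\<close>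

lemma cof_insert:
  assumes "l \<notin> \<beta>" "k \<in> \<beta>"
  shows "cof (insert l \<beta>) B k l = - (\<Sum>i\<in>UNIV. cof \<beta> B k i * B $ i $ l)"
proof -
  have "cof (insert l \<beta>) B k l =
      (\<Sum>c\<in>paths k \<beta>. - (path_sign c * mdet (\<beta> - set c) B * path_prod B (c @ [l])))"
    unfolding cof_def
  proof (rule sum.reindex_bij_witness[where i = "\<lambda>c. c @ [l]" and j = butlast])
    fix c assume "c \<in> {c. c \<in> paths k (insert l \<beta>) \<and> last c = l}"
    then have c: "c \<in> paths k (insert l \<beta>)" "last c = l" by auto
    then obtain d where d: "c = d @ [l]" by (metis (mono_tags, lifting) append_butlast_last_id mem_Collect_eq paths_def)
    have "d \<noteq> []" using c assms d by (auto simp: paths_def)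
    then show "butlast c \<in> paths k \<beta>" using c d by (auto simp: paths_def)
    show "butlast c @ [l] = c" using d by simp
    have "insert l \<beta> - set c = \<beta> - set d" using d assms by auto
    then show "- (path_sign (butlast c) * mdet (\<beta> - set (butlast c)) B * path_prod B (butlast c @ [l])) =
        path_sign c * mdet (insert l \<beta> - set c) B * path_prod B c"
      using d by (simp add: path_sign_append) (simp add: path_sign_def)
  next
    fix c assume "c \<in> paths k \<beta>"
    then show "butlast (c @ [l]) = c" "c @ [l] \<in> {c. c \<in> paths k (insert l \<beta>) \<and> last c = l}"
      using assms by (auto simp: paths_def)
  qed
  then show ?thesis by (simp add: sum_cof_column sum_negf)
qed

text \<open>The only path from \<open>k\<close> that also ends in \<open>k\<close> is the one-vertex
  path.\<close>

lemma cof_diag: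
  assumes "k \<in> \<beta>"
  shows "cof \<beta> B k k = mdet (\<beta> - {k}) B"
proof -
  have "c = [k]" if c: "c \<in> paths k \<beta>" "last c = k" for c
  proof -
    from c(1) obtain d where "c = k # d" "k \<notin> set d" by (cases c) (auto simp: paths_def)
    then show ?thesis using c(2) by (cases "d = []") (auto dest: last_in_set)
  qed
  then have "{c. c \<in> paths k \<beta> \<and> last c = k} = {[k]}"
    using assms by (auto simp: paths_def)
  then show ?thesis by (simp add: cof_def path_sign_def)
qed

section \<open>The recursion for sums of cofactors and of principal minors\<close>

definition minor_sum :: "nat \<Rightarrow> quat^('n::{finite,linorder})^('n::{finite,linorder}) \<Rightarrow> real" where
  "minor_sum s B = (\<Sum>\<beta>\<in>J s. qRe (mdet \<beta> B))"

definition cof_sum :: "nat \<Rightarrow> quat^('n::{finite,linorder})^('n::{finite,linorder}) \<Rightarrow> quat^('n::{finite,linorder})^('n::{finite,linorder})" where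
  "cof_sum s B = (\<chi> k i. \<Sum>\<beta>\<in>J_at s k. cof \<beta> B k i)"

text \<open>In entry \<open>(k, l)\<close> of the product, index sets containing \<open>l\<close>
  fall under Cramer's rule and the others under \<open>cof_insert\<close>. For \<open>l = k\<close>
  the product supplies the minors on sets containing \<open>k\<close>, and the diagonal cofactors of
  order \<open>Suc s\<close> those on sets avoiding \<open>k\<close>. For
  \<open>l \<noteq> k\<close> the cofactors of the two orders cancel.\<close>

lemma cof_sum_Suc:
  fixes B :: "quat^('n::{finite,linorder})^('n::{finite,linorder})"
  assumes B: "hermitian B"
  shows "cof_sum (Suc s) B + cof_sum s B ** B = minor_sum s B *\<^sub>R mat 1"
proof -
  have real: "of_real (qRe (mdet \<beta> B)) = mdet \<beta> B" for \<beta> :: "'n set"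
    using hermitian_cdet_mdet[OF B] by (simp add: of_real_qRe)
  have "(cof_sum (Suc s) B) $ k $ l + (cof_sum s B ** B) $ k $ l = (minor_sum s B *\<^sub>R mat 1) $ k $ l" for k l
  proof -
    have "(cof_sum s B ** B) $ k $ l = (\<Sum>\<beta>\<in>J_at s k. \<Sum>i\<in>UNIV. cof \<beta> B k i * B $ i $ l)"
      unfolding matrix_matrix_mult_def cof_sum_def by (simp add: sum_distrib_right) (rule sum.swap)
    also have "\<dots> = (\<Sum>\<beta>\<in>J_at s k. if l \<in> \<beta> then if l = k then mdet \<beta> B else 0 else - cof (insert l \<beta>) B k l)"
      by (intro sum.cong refl) (auto simp: J_at_def cof_mult_column[OF B] cof_insert)
    also have "\<dots> = (\<Sum>\<beta> | \<beta> \<in> J_at s k \<and> l \<in> \<beta>. if l = k then mdet \<beta> B else 0) +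
        (\<Sum>\<beta> | \<beta> \<in> J_at s k \<and> l \<notin> \<beta>. - cof (insert l \<beta>) B k l)"
      by (subst sum.If_cases) (auto simp: Int_def)
    finally have 1: "(cof_sum s B ** B) $ k $ l = \<dots>" .
    show ?thesis
    proof (cases "l = k")
      case True
      have "(cof_sum (Suc s) B) $ k $ k = (\<Sum>\<beta>\<in>J_at (Suc s) k. mdet (\<beta> - {k}) B)"
        unfolding cof_sum_def by (simp add: J_at_def cof_diag)
      also have "\<dots> = (\<Sum>\<beta> | \<beta> \<in> J s \<and> k \<notin> \<beta>. mdet \<beta> B)"
        by (rule sum.reindex_bij_witness[where i = "insert k" and j = "\<lambda>\<beta>. \<beta> - {k}"])
          (auto simp: J_at_def J_def)
      finally have "(cof_sum (Suc s) B) $ k $ k = \<dots>" .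
      moreover have "(cof_sum s B ** B) $ k $ k = (\<Sum>\<beta> | \<beta> \<in> J s \<and> k \<in> \<beta>. mdet \<beta> B)"
        using 1 True by (simp add: J_at_def)
      moreover have "(\<Sum>\<beta>\<in>J s. mdet \<beta> B) =
          (\<Sum>\<beta> | \<beta> \<in> J s \<and> k \<notin> \<beta>. mdet \<beta> B) + (\<Sum>\<beta> | \<beta> \<in> J s \<and> k \<in> \<beta>. mdet \<beta> B)"
        by (subst sum.union_disjoint[symmetric]) (auto intro: sum.cong)
      moreover have "of_real (minor_sum s B) = (\<Sum>\<beta>\<in>J s. mdet \<beta> B)"
        unfolding minor_sum_def by (simp add: real)
      ultimately show ?thesis using True by (simp add: mat_def of_real_def)
    next
      case False
      have "(cof_sum (Suc s) B) $ k $ l = (\<Sum>\<beta> | \<beta> \<in> J_at (Suc s) k \<and> l \<in> \<beta>. cof \<beta> B k l)"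
        unfolding cof_sum_def vec_lambda_beta by (intro sum.mono_neutral_cong_right) (auto simp: cof_outside)
      also have "\<dots> = (\<Sum>\<beta> | \<beta> \<in> J_at s k \<and> l \<notin> \<beta>. cof (insert l \<beta>) B k l)"
        by (rule sum.reindex_bij_witness[where i = "insert l" and j = "\<lambda>\<beta>. \<beta> - {l}"])
          (use False in \<open>auto simp: J_at_def J_def insert_absorb\<close>)
      finally show ?thesis using 1 False by (simp add: sum_negf mat_def)
    qed
  qed
  then show ?thesis by (simp add: vec_eq_iff)
qed

lemma cof_sum_0 [simp]: "cof_sum 0 B = 0"
proof -
  have "J_at 0 k = {}" for k :: 'a
    by (auto simp: J_at_def J_def)
  then show ?thesis by (simp add: cof_sum_def vec_eq_iff)
qed

lemma minor_sum_0 [simp]: "minor_sum 0 B = 1"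
  by (simp add: minor_sum_def J_def)

lemma cof_sum_card:
  fixes B :: "quat^('n::{finite,linorder})^('n::{finite,linorder})"
  assumes "s > CARD('n)"
  shows "cof_sum s B = 0"
proof -
  have "J_at s k = {}" for k :: 'n
  proof -
    have "card \<beta> \<le> CARD('n)" for \<beta> :: "'n set" by (rule card_mono) auto
    then have "card \<beta> \<noteq> s" for \<beta> :: "'n set" using assms by (metis not_le)
    then show ?thesis by (simp add: J_at_def J_def)
  qed
  then show ?thesis by (simp add: cof_sum_def vec_eq_iff)
qed

section \<open>Quadratic forms and positivity of principal minors\<close>

lemma adj_nth [simp]: "adj A $ i $ j = qcnj (A $ j $ i)"
  by (simp add: adj_def)

lemma adj_simps [simp]:
  "adj (A ** B) = adj B ** adj A" "adj (adj A) = A" "adj (mat 1) = mat 1" "adj 0 = 0"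
  "adj (A + C) = adj A + adj C" "adj (A - C) = adj A - adj C" "adj (r *\<^sub>R A) = r *\<^sub>R adj A"
  by (simp_all add: vec_eq_iff matrix_matrix_mult_def mat_def)

lemma matrix_mult_minus_distrib:
  fixes A :: "'a::ring_1^'n^'m"
  shows "A ** (B - C) = A ** B - A ** C" "(D - E) ** A = D ** A - E ** A"
  by (simp_all add: vec_eq_iff matrix_matrix_mult_def right_diff_distrib left_diff_distrib sum_subtractf)

lemma matrix_add_rdistrib: "(A + B) ** C = A ** C + B ** C"
  by (simp add: vec_eq_iff matrix_matrix_mult_def distrib_right sum.distrib)

lemma scaleR_matrix_vector: "(r *\<^sub>R A) *v x = r *\<^sub>R (A *v x)" for A :: "quat^'n^'m"
  by (simp add: vec_eq_iff matrix_vector_mult_def scaleR_sum_right)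

definition qdot :: "quat^'n \<Rightarrow> quat^'n \<Rightarrow> quat" where
  "qdot x y = (\<Sum>i\<in>UNIV. qcnj (x $ i) * y $ i)"

lemma qdot_zero [simp]: "qdot 0 y = 0" "qdot x 0 = 0"
  by (simp_all add: qdot_def)

lemma qdot_add: "qdot x (y + z) = qdot x y + qdot x z"
  by (simp add: qdot_def distrib_left sum.distrib)

lemma qdot_scaleR: "qdot x (r *\<^sub>R y) = of_real r * qdot x y"
  by (simp add: qdot_def scaleR_sum_right flip: scaleR_conv_of_real)

lemma qdot_matrix: "qdot x (A *v y) = qdot (adj A *v x) y"
proof -
  have "qdot x (A *v y) = (\<Sum>i\<in>UNIV. \<Sum>j\<in>UNIV. qcnj (x $ i) * A $ i $ j * y $ j)"
    by (simp add: qdot_def matrix_vector_mult_def sum_distrib_left mult.assoc)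
  also have "\<dots> = (\<Sum>j\<in>UNIV. \<Sum>i\<in>UNIV. qcnj (x $ i) * A $ i $ j * y $ j)"
    by (rule sum.swap)
  also have "\<dots> = qdot (adj A *v x) y"
    by (simp add: qdot_def matrix_vector_mult_def sum_distrib_right)
  finally show ?thesis .
qed

definition sqn :: "quat^'n \<Rightarrow> real" where
  "sqn x = (\<Sum>i\<in>UNIV. (qRe (x $ i))\<^sup>2 + (qIm1 (x $ i))\<^sup>2 + (qIm2 (x $ i))\<^sup>2 + (qIm3 (x $ i))\<^sup>2)"

lemma qdot_self: "qdot x x = of_real (sqn x)"
proof -
  have "qcnj y * y = of_real ((qRe y)\<^sup>2 + (qIm1 y)\<^sup>2 + (qIm2 y)\<^sup>2 + (qIm3 y)\<^sup>2)" for y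
    by (simp add: quat_eq_iff power2_eq_square)
  then show ?thesis by (simp add: qdot_def sqn_def)
qed

lemma sqn_pos: "x \<noteq> 0 \<Longrightarrow> sqn x > 0"
proof -
  assume "x \<noteq> 0"
  then obtain i where "x $ i \<noteq> 0" by (auto simp: vec_eq_iff)
  then have "(qRe (x $ i))\<^sup>2 + (qIm1 (x $ i))\<^sup>2 + (qIm2 (x $ i))\<^sup>2 + (qIm3 (x $ i))\<^sup>2 \<noteq> 0"
    by (auto simp: quat_eq_iff add_nonneg_eq_0_iff)
  then have "(qRe (x $ i))\<^sup>2 + (qIm1 (x $ i))\<^sup>2 + (qIm2 (x $ i))\<^sup>2 + (qIm3 (x $ i))\<^sup>2 > 0"
    by (metis less_eq_real_def add_nonneg_nonneg zero_le_power2)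
  then show ?thesis unfolding sqn_def by (intro sum_pos2[of _ i]) auto
qed

lemma pos_def_qdot:
  "pos_def P \<longleftrightarrow> hermitian P \<and> (\<forall>x. x \<noteq> 0 \<longrightarrow> (\<exists>t>0. qdot x (P *v x) = of_real t))"
  by (simp add: pos_def_def qdot_def)

lemma pos_def_hermitian: "pos_def P \<Longrightarrow> hermitian P"
  by (simp add: pos_def_def)

lemma hermitian_adj: "hermitian B \<Longrightarrow> adj B = B"
  by (simp add: hermitian_def)

lemma qdot_congruence: "qdot x ((adj A ** M ** A) *v x) = qdot (A *v x) (M *v (A *v x))"
  by (simp add: matrix_vector_mul_assoc[symmetric] qdot_matrix[of x "adj A"])

lemma hermitian_congruence: "hermitian M \<Longrightarrow> hermitian (adj A ** M ** A)"
  by (simp add: hermitian_def matrix_mul_assoc)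

lemma pos_def_kernel:
  assumes "pos_def M" "qdot x (M *v x) = 0"
  shows "x = 0"
  using assms unfolding pos_def_qdot by (metis less_irrefl of_real_eq_0_iff)

lemma pos_def_congruence:
  assumes "pos_def M" "\<And>x. A *v x = 0 \<Longrightarrow> x = 0"
  shows "pos_def (adj A ** M ** A)"
  using assms hermitian_congruence[of M A] unfolding pos_def_qdot qdot_congruence by blast

text \<open>A test vector supported on \<open>\<beta>\<close> that turns cofactor identities into
  statements about the quadratic form of \<open>G\<close>.\<close>

definition cof_row :: "('n::{finite,linorder}) set \<Rightarrow> quat^('n::{finite,linorder})^('n::{finite,linorder}) \<Rightarrow> 'n \<Rightarrow> quat^('n::{finite,linorder})" where
  "cof_row \<beta> G k = (\<chi> i. qcnj (cof \<beta> G k i))"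

lemma matrix_cof_row:
  fixes G :: "quat^('n::{finite,linorder})^('n::{finite,linorder})"
  assumes G: "hermitian G"
  shows "(G *v cof_row \<beta> G k) $ l = qcnj (\<Sum>i\<in>UNIV. cof \<beta> G k i * G $ i $ l)"
  by (simp add: cof_row_def matrix_vector_mult_def hermitian_nth[OF G])

text \<open>On the coordinates in \<open>\<beta>\<close>, Cramer's rule makes the image of the test
  vector vanish except at \<open>k\<close>; outside \<open>\<beta>\<close> the test vector itself
  vanishes. Only the summand at \<open>k\<close> survives.\<close>

lemma qdot_cof_row:
  fixes G :: "quat^('n::{finite,linorder})^('n::{finite,linorder})"
  assumes G: "hermitian G" and k: "k \<in> \<beta>"
  shows "qdot (cof_row \<beta> G k) (G *v cof_row \<beta> G k) = mdet (\<beta> - {k}) G * mdet \<beta> G"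
proof -
  have *: "qcnj (cof_row \<beta> G k $ l) * (G *v cof_row \<beta> G k) $ l = (if l = k then mdet (\<beta> - {k}) G * mdet \<beta> G else 0)" for l
  proof (cases "l \<in> \<beta>")
    case True
    have "qcnj (mdet \<beta> G) = mdet \<beta> G"
      using hermitian_cdet_mdet[OF G] Reals_iff_qcnj by blast
    then have "(G *v cof_row \<beta> G k) $ l = (if l = k then mdet \<beta> G else 0)"
      unfolding matrix_cof_row[OF G] cof_mult_column[OF G k True] by simp
    then show ?thesis by (simp add: cof_row_def cof_diag[OF k])
  next
    case False
    then show ?thesis using k by (auto simp: cof_row_def cof_outside)
  qed
  show ?thesis unfolding qdot_def * by simp
qed

text \<open>One direction of Sylvester's criterion. At \<open>cof_row\<close> the form equals the
  product of the minors on \<open>\<beta>\<close> and on \<open>\<beta> - {k}\<close>, and the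
  smaller minor is positive by induction. Positivity is asked only of vectors supported on
  \<open>\<beta>\<close>, so that singular Gram matrices are covered as well.\<close>

lemma mdet_pos:
  fixes G :: "quat^('n::{finite,linorder})^('n::{finite,linorder})"
  assumes G: "hermitian G"
    and pos: "\<And>x. x \<noteq> 0 \<Longrightarrow> (\<And>i. i \<notin> \<beta> \<Longrightarrow> x $ i = 0) \<Longrightarrow> \<exists>t>0. qdot x (G *v x) = of_real t"
  shows "qRe (mdet \<beta> G) > 0"
  using pos
proof (induction "card \<beta>" arbitrary: \<beta>)
  case 0
  then show ?case by simp
next
  case (Suc n)
  then obtain k where k: "k \<in> \<beta>" by fastforce
  have "n = card (\<beta> - {k})" using Suc(2) k by simp
  then have IH: "qRe (mdet (\<beta> - {k}) G) > 0"
    using Suc(1)[of "\<beta> - {k}"] Suc(3) by auto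
  have "cof_row \<beta> G k $ k \<noteq> 0"
    using IH by (auto simp: cof_row_def cof_diag[OF k] quat_eq_iff)
  then have "cof_row \<beta> G k \<noteq> 0" by auto
  moreover have "cof_row \<beta> G k $ i = 0" if "i \<notin> \<beta>" for i
    using that by (simp add: cof_row_def cof_outside)
  ultimately obtain t where "t > 0" "mdet (\<beta> - {k}) G * mdet \<beta> G = of_real t"
    using Suc(3) unfolding qdot_cof_row[OF G k, symmetric] by blast
  moreover have "mdet (\<beta> - {k}) G \<in> \<real>" using hermitian_cdet_mdet[OF G] by blast
  ultimately have "qRe (mdet (\<beta> - {k}) G) * qRe (mdet \<beta> G) > 0"
    by (metis qRe_mult_Reals of_real_sel(1))
  then show ?case using IH by (simp add: zero_less_mult_iff)
qed

text \<open>By the recursion, \<open>cof_sum s G\<close> is a polynomial in \<open>G\<close> with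
  real coefficients.\<close>

lemma cof_sum_polynomial:
  fixes G :: "quat^('n::{finite,linorder})^('n::{finite,linorder})"
  assumes G: "hermitian G"
  shows "adj (cof_sum s G) = cof_sum s G \<and> cof_sum s G ** G = G ** cof_sum s G"
proof (induction s)
  case (Suc s)
  have eq: "cof_sum (Suc s) G = minor_sum s G *\<^sub>R mat 1 - cof_sum s G ** G"
    using cof_sum_Suc[OF G, of s] by (simp add: algebra_simps)
  show ?case
    unfolding eq using Suc G
    by (simp add: hermitian_def matrix_mult_minus_distrib matrix_scalar_ac matrix_mul_assoc
        flip: scalar_matrix_assoc) (metis matrix_mul_assoc)
qed simp

lemma J_card: "J CARD('n::{finite,linorder}) = {UNIV :: 'n set}"
  using card_subset_eq[of "UNIV :: 'n set"] by (auto simp: J_def)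

lemma minor_sum_card:
  "minor_sum CARD('n) (G :: quat^('n::{finite,linorder})^('n::{finite,linorder})) = qRe (mdet UNIV G)"
  by (simp add: minor_sum_def J_card)

lemma pos_def_mdet_pos:
  fixes G :: "quat^('n::{finite,linorder})^('n::{finite,linorder})"
  assumes "pos_def G"
  shows "qRe (mdet UNIV G) > 0"
  using assms unfolding pos_def_qdot by (intro mdet_pos) auto

text \<open>There are no index sets of order above \<open>CARD('n)\<close>, so the recursion stops
  with a multiple of the identity.\<close>

lemma cof_sum_inverse:
  fixes G :: "quat^('n::{finite,linorder})^('n::{finite,linorder})"
  assumes "hermitian G"
  shows "cof_sum CARD('n) G ** G = qRe (mdet UNIV G) *\<^sub>R mat 1"
  using cof_sum_Suc[OF assms, of "CARD('n)"] by (simp add: cof_sum_card minor_sum_card)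

lemma matrix_inv_equality:
  assumes "A ** B = mat 1" "B ** A = mat 1"
  shows "matrix_inv A = B"
  unfolding matrix_inv_def
proof (rule some_equality)
  fix C assume C: "A ** C = mat 1 \<and> C ** A = mat 1"
  have "C = (B ** A) ** C" using assms by simp
  also have "\<dots> = B" using C by (simp flip: matrix_mul_assoc)
  finally show "C = B" .
qed (use assms in simp)

lemma pos_def_inverse:
  fixes P :: "quat^('n::{finite,linorder})^('n::{finite,linorder})"
  assumes P: "pos_def P"
  shows "P ** matrix_inv P = mat 1" "matrix_inv P ** P = mat 1" "pos_def (matrix_inv P)"
proof -
  note h = pos_def_hermitian[OF P]
  let ?d = "qRe (mdet UNIV P)"
  let ?C = "(1 / ?d) *\<^sub>R cof_sum CARD('n) P"
  have d: "?d > 0" using pos_def_mdet_pos[OF P] .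
  have 1: "?C ** P = mat 1"
    using d cof_sum_inverse[OF h] by (simp flip: scalar_matrix_assoc)
  moreover have 2: "P ** ?C = mat 1"
    using 1 cof_sum_polynomial[OF h, of "CARD('n)"] by (simp add: matrix_scalar_ac flip: scalar_matrix_assoc)
  ultimately have C: "matrix_inv P = ?C" by (intro matrix_inv_equality)
  show "P ** matrix_inv P = mat 1" "matrix_inv P ** P = mat 1" unfolding C using 1 2 by auto
  have adj: "adj ?C = ?C" using cof_sum_polynomial[OF h] by simp
  have "x = 0" if "?C *v x = 0" for x
    using that 2 by (metis matrix_vector_mul_assoc matrix_vector_mul_lid matrix_vector_mult_0_right)
  \<comment> \<open>The inverse is congruent to \<open>P\<close> by way of itself.\<close>
  from pos_def_congruence[OF P, of ?C, OF this] have "pos_def (?C ** P ** ?C)" unfolding adj .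
  then show "pos_def (matrix_inv P)" unfolding C 1 by simp
qed

section \<open>Positive definite square roots\<close>

text \<open>Horner evaluation. Real coefficients are central, which makes the evaluation
  multiplicative.\<close>

definition poly_matrix :: "real poly \<Rightarrow> quat^'n^'n \<Rightarrow> quat^'n^'n" where
  "poly_matrix p P = fold_coeffs (\<lambda>a X. a *\<^sub>R mat 1 + P ** X) p 0"

lemma poly_matrix_0 [simp]: "poly_matrix 0 P = 0"
  by (simp add: poly_matrix_def)

lemma poly_matrix_pCons [simp]: "poly_matrix (pCons a p) P = a *\<^sub>R mat 1 + P ** poly_matrix p P"
  by (cases "p = 0 \<and> a = 0") (auto simp: poly_matrix_def)

lemma poly_matrix_add [simp]: "poly_matrix (p + q) P = poly_matrix p P + poly_matrix q P"
  by (induction p q rule: poly_induct2) (simp_all add: matrix_add_ldistrib scaleR_add_left)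

lemma poly_matrix_smult [simp]: "poly_matrix (smult a p) P = a *\<^sub>R poly_matrix p P"
  by (induction p) (simp_all add: matrix_scalar_ac scaleR_add_right flip: scalar_matrix_assoc)

lemma poly_matrix_minus [simp]: "poly_matrix (- p) P = - poly_matrix p P"
  using poly_matrix_smult[of "-1" p P] by simp

lemma poly_matrix_mult: "poly_matrix (p * q) P = poly_matrix p P ** poly_matrix q P"
  by (induction p) (simp_all add: matrix_add_rdistrib matrix_mul_assoc flip: scalar_matrix_assoc)

lemma poly_matrix_commute:
  assumes "X ** P = P ** X"
  shows "X ** poly_matrix p P = poly_matrix p P ** X"
proof (induction p)
  case (pCons a p)
  have "X ** (P ** poly_matrix p P) = P ** poly_matrix p P ** X"
    using assms pCons.IH by (metis matrix_mul_assoc)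
  then show ?case
    by (simp add: matrix_add_ldistrib matrix_add_rdistrib matrix_scalar_ac flip: scalar_matrix_assoc)
qed simp

lemma poly_matrix_hermitian: "hermitian P \<Longrightarrow> adj (poly_matrix p P) = poly_matrix p P"
  by (induction p) (use poly_matrix_commute[of P P] in \<open>auto simp: hermitian_def\<close>)

text \<open>Unrolling the recursion writes each \<open>cof_sum s G\<close> as a real polynomial in
  \<open>G\<close>. At order \<open>Suc CARD('n)\<close> its value is zero, while its coefficient of
  degree \<open>CARD('n)\<close> is 1 or -1.\<close>

lemma Cayley_Hamilton:
  fixes G :: "quat^('n::{finite,linorder})^('n::{finite,linorder})"
  assumes G: "hermitian G"
  obtains p where "p \<noteq> 0" "poly_matrix p G = 0"
proof -
  define c where "c = rec_nat 0 (\<lambda>s p. pCons (minor_sum s G) (- p))"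
  have c: "c 0 = 0" "c (Suc s) = pCons (minor_sum s G) (- c s)" for s
    by (simp_all add: c_def)
  have "poly_matrix (c s) G = cof_sum s G" for s
  proof (induction s)
    case (Suc s)
    have "G ** (- cof_sum s G) = - (cof_sum s G ** G)"
      using cof_sum_polynomial[OF G, of s] matrix_mult_minus_distrib(1)[of G 0 "cof_sum s G"] by simp
    then show ?case using cof_sum_Suc[OF G, of s] Suc by (simp add: c algebra_simps)
  qed (simp add: c)
  moreover have "coeff (c (Suc s)) s = (-1) ^ s" for s
  proof (induction s)
    case (Suc s)
    then show ?case using c(2)[of "Suc s"] by simp
  qed (simp add: c)
  then have "c (Suc CARD('n)) \<noteq> 0"
    by (metis coeff_0 power_eq_0_iff zero_neq_neg_one)
  ultimately show ?thesis using that[of "c (Suc CARD('n))"] by (simp add: cof_sum_card)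
qed

section \<open>Cancelling factors at Hermitian and positive definite matrices\<close>

lemma injective_matrix_cancel:
  fixes A :: "quat^'n^'m" and W :: "quat^'p^'n"
  assumes "\<And>x. A *v x = 0 \<Longrightarrow> x = 0" "A ** W = 0"
  shows "W = 0"
proof -
  have "W *v y = 0" for y
    using assms(1)[of "W *v y"] assms(2) by (simp add: matrix_vector_mul_assoc)
  then show ?thesis by (simp add: matrix_eq)
qed

lemma qdot_self_eq_0: "qdot x x = 0 \<Longrightarrow> x = 0"
  using sqn_pos[of x] unfolding qdot_self by auto

lemma sqn_nonneg: "sqn x \<ge> 0"
  unfolding sqn_def by (intro sum_nonneg) auto

text \<open>Moving one factor \<open>L\<close> across the inner product shows that
  \<open>L *v x\<close> has norm zero. This is what removes repeated roots.\<close>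

lemma hermitian_square_kernel:
  assumes "adj L = L" "L *v (L *v x) = 0"
  shows "L *v x = 0"
  using qdot_matrix[of "L *v x" L x] assms by (intro qdot_self_eq_0) simp

text \<open>Pairing with \<open>x\<close> gives \<open>sqn (L *v x) + b\<^sup>2 * sqn x\<close>,
  which is positive for nonzero \<open>x\<close>. This excludes non-real roots.\<close>

lemma hermitian_square_plus_kernel:
  assumes "adj L = L" "b \<noteq> 0" "L *v (L *v x) + b\<^sup>2 *\<^sub>R x = 0"
  shows "x = 0"
proof (rule ccontr)
  assume "x \<noteq> 0"
  have "qdot x (L *v (L *v x)) = of_real (sqn (L *v x))"
    using qdot_matrix[of x L "L *v x"] assms(1) by (simp add: qdot_self)
  then have "of_real (sqn (L *v x) + b\<^sup>2 * sqn x) = qdot x (L *v (L *v x) + b\<^sup>2 *\<^sub>R x)"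
    by (simp add: qdot_add qdot_scaleR qdot_self)
  also have "\<dots> = 0" using assms(3) by simp
  finally have "sqn (L *v x) + b\<^sup>2 * sqn x = 0" by (simp only: of_real_eq_0_iff)
  moreover have "b\<^sup>2 * sqn x > 0" using assms(2) sqn_pos[OF \<open>x \<noteq> 0\<close>] by simp
  ultimately show False using sqn_nonneg[of "L *v x"] by simp
qed

text \<open>For an eigenvector \<open>x\<close> with eigenvalue \<open>l\<close> the form would take
  the value \<open>l * sqn x\<close>, which is not positive.\<close>

lemma pos_def_shift_kernel:
  assumes P: "pos_def P" and "l \<le> 0" "(P - l *\<^sub>R mat 1) *v x = 0"
  shows "x = 0"
proof (rule ccontr)
  assume "x \<noteq> 0"
  then obtain t where t: "t > 0" "qdot x (P *v x) = of_real t" using P by (auto simp: pos_def_qdot)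
  have "P *v x = l *\<^sub>R x"
    using assms(3) by (simp add: matrix_vector_mult_diff_rdistrib scaleR_matrix_vector)
  then have "of_real t = (of_real (l * sqn x) :: quat)"
    using t(2) by (simp add: qdot_scaleR qdot_self)
  then have "t = l * sqn x" by (simp only: of_real_eq_iff)
  then show False using t(1) assms(2) sqn_nonneg[of x] by (simp add: mult_nonpos_nonneg leD)
qed

lemma
  fixes p q :: "real poly" and z :: complex
  shows poly_of_real_add: "poly (map_poly of_real (p + q)) z =
      poly (map_poly of_real p) z + poly (map_poly of_real q) z"
    and poly_of_real_mult: "poly (map_poly of_real (p * q)) z =
      poly (map_poly of_real p) z * poly (map_poly of_real q) z"
    and poly_of_real_of_real: "poly (map_poly of_real p) (of_real x :: complex) = of_real (poly p x)"
proof -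
  have C: "map_poly complex_of_real (pCons a r) = pCons (of_real a) (map_poly of_real r)" for a r
    by (simp add: map_poly_pCons)
  show add: "poly (map_poly of_real (p + q)) z = poly (map_poly of_real p) z + poly (map_poly of_real q) z"
    for p q :: "real poly"
    by (induction p q rule: poly_induct2) (simp_all add: C algebra_simps)
  have smult: "poly (map_poly of_real (smult a q)) z = of_real a * poly (map_poly of_real q) z" for a
    by (induction q) (simp_all add: C algebra_simps)
  show "poly (map_poly of_real (p * q)) z = poly (map_poly of_real p) z * poly (map_poly of_real q) z"
    by (induction p) (simp_all add: C add smult algebra_simps)
  show "poly (map_poly of_real p) (of_real x :: complex) = of_real (poly p x)"
    by (induction p) (simp_all add: C)
qed

text \<open>The quadratic has the roots \<open>z\<close> and its conjugate. The remainder of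
  \<open>p\<close> modulo it is linear, real and zero at the non-real \<open>z\<close>, so both of
  its coefficients vanish.\<close>

lemma real_poly_complex_root_dvd:
  fixes p :: "real poly"
  assumes "poly (map_poly of_real p) z = 0" "Im z \<noteq> 0"
  shows "[:(Re z)\<^sup>2 + (Im z)\<^sup>2, - 2 * Re z, 1:] dvd p"
proof -
  let ?m = "[:(Re z)\<^sup>2 + (Im z)\<^sup>2, - 2 * Re z, 1:]"
  define r where "r = p mod ?m"
  have m: "poly (map_poly of_real ?m) z = 0"
    by (simp add: map_poly_pCons complex_eq_iff power2_eq_square algebra_simps)
  have "p = ?m * (p div ?m) + r" by (simp only: r_def mult_div_mod_eq)
  then have "poly (map_poly of_real p) z =
      poly (map_poly of_real ?m) z * poly (map_poly of_real (p div ?m)) z + poly (map_poly of_real r) z"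
    by (metis poly_of_real_add poly_of_real_mult)
  then have rz: "poly (map_poly of_real r) z = 0" using assms(1) m by simp
  have "r = 0 \<or> degree r < degree ?m" unfolding r_def by (rule degree_mod_less) simp
  then have "degree r \<le> 1" by auto
  obtain c r' where r': "r = pCons c r'" by (cases r)
  then have "degree r' = 0" using \<open>degree r \<le> 1\<close> by (auto split: if_splits)
  then obtain d where cd: "r = [:c, d:]" using r' by (auto elim: degree_eq_zeroE)
  then have "c + d * Re z = 0" "d * Im z = 0"
    using rz by (auto simp: map_poly_pCons complex_eq_iff mult.commute)
  then have "r = 0" using assms(2) cd by simp
  then show ?thesis by (simp add: r_def mod_eq_0_iff_dvd)
qed

lemma root_product_split:
  fixes L :: "real set"
  assumes "finite L" "l \<in> L"
  shows "(\<Prod>x\<in>L. [:- x, 1:]) = [:- l, 1:] * (\<Prod>x\<in>L - {l}. [:- x, 1:])"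
  using assms by (rule prod.remove)

text \<open>
  Every factor of an annihilating polynomial other than simple roots \<open>\<lambda> > 0\<close> is injective
  at a positive definite matrix, hence may be cancelled.
\<close>

lemma pos_def_annihilator:
  fixes P :: "quat^'n^'n" and V :: "quat^'n^'n"
  assumes P: "pos_def P"
  shows "p \<noteq> 0 \<Longrightarrow> poly_matrix p P ** V = 0 \<Longrightarrow>
    \<exists>L. finite L \<and> (\<forall>l\<in>L. l > 0) \<and> poly_matrix (\<Prod>l\<in>L. [:- l, 1:]) P ** V = 0"
proof (induction "degree p" arbitrary: p V rule: less_induct)
  case less
  have hP: "hermitian P" using pos_def_hermitian[OF P] .
  have comm: "poly_matrix q P ** poly_matrix r P = poly_matrix r P ** poly_matrix q P" for q r
    by (metis mult.commute poly_matrix_mult)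
  have lin: "poly_matrix [:- l, 1:] P = P - l *\<^sub>R mat 1" for l
    by simp
  show ?case
  proof (cases "degree p = 0")
    case True
    then obtain a where "p = [:a:]" "a \<noteq> 0" using less(2) by (metis degree_eq_zeroE pCons_0_0)
    then have "V = 0" using less(3) by (simp flip: scalar_matrix_assoc)
    then show ?thesis by (intro exI[of _ "{}"]) simp
  next
    case False
    then have "\<not> constant (poly (map_poly complex_of_real p))"
      by (simp add: constant_degree degree_map_poly)
    then obtain z where z: "poly (map_poly complex_of_real p) z = 0"
      using fundamental_theorem_of_algebra by blast
    show ?thesis
    proof (cases "Im z = 0")
      case False
      let ?m = "[:(Re z)\<^sup>2 + (Im z)\<^sup>2, - 2 * Re z, 1:]"
      obtain q where q: "p = ?m * q" using real_poly_complex_root_dvd[OF z False] by (elim dvdE)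
      then have "q \<noteq> 0" using less(2) by auto
      then have deg: "degree q < degree p" unfolding q by (subst degree_mult_eq) auto
      let ?A = "P - Re z *\<^sub>R mat 1"
      have A: "adj ?A = ?A" using hP by (simp add: hermitian_def)
      \<comment> \<open>Completing the square exhibits the quadratic factor as a Hermitian square
        plus a positive multiple of the identity.\<close>
      have "?m = [:- Re z, 1:] * [:- Re z, 1:] + [:(Im z)\<^sup>2:]"
        by (simp add: power2_eq_square)
      then have m: "poly_matrix ?m P = ?A ** ?A + (Im z)\<^sup>2 *\<^sub>R mat 1"
        by (simp only: poly_matrix_add poly_matrix_mult lin) simp
      have "poly_matrix q P ** V = 0"
      proof (rule injective_matrix_cancel)
        show "x = 0" if "poly_matrix ?m P *v x = 0" for x
          using that hermitian_square_plus_kernel[OF A False, of x] unfolding m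
          by (simp add: matrix_vector_mult_add_rdistrib scaleR_matrix_vector matrix_vector_mul_assoc)
        show "poly_matrix ?m P ** (poly_matrix q P ** V) = 0"
          using less(3) unfolding q poly_matrix_mult by (simp only: matrix_mul_assoc)
      qed
      then show ?thesis using less(1)[OF deg \<open>q \<noteq> 0\<close>] by blast
    next
      case True
      define l where "l = Re z"
      have "z = of_real l" using True by (simp add: complex_eq_iff l_def)
      then have "poly p l = 0" using z by (simp add: poly_of_real_of_real)
      then obtain q where q: "p = [:- l, 1:] * q" by (auto simp: poly_eq_0_iff_dvd elim!: dvdE)
      then have "q \<noteq> 0" using less(2) by auto
      then have deg: "degree q < degree p" unfolding q by (subst degree_mult_eq) auto
      let ?A = "poly_matrix [:- l, 1:] P"
      \<comment> \<open>The linear factor is absorbed into \<open>V\<close>, over which the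
        induction is general, so that the hypothesis applies to \<open>q\<close>.\<close>
      have "poly_matrix q P ** (?A ** V) = 0"
        using less(3) comm unfolding q poly_matrix_mult by (metis matrix_mul_assoc)
      then obtain L where L: "finite L" "\<forall>l\<in>L. l > 0" "poly_matrix (\<Prod>l\<in>L. [:- l, 1:]) P ** (?A ** V) = 0"
        using less(1)[OF deg \<open>q \<noteq> 0\<close>] by blast
      let ?Q = "poly_matrix (\<Prod>l\<in>L. [:- l, 1:]) P"
      have AQ: "?A ** (?Q ** V) = 0" using L(3) comm by (metis matrix_mul_assoc)
      \<comment> \<open>A nonpositive root is cancelled, a root already in \<open>L\<close> is a
        repetition and is dropped, and a new positive root joins \<open>L\<close>.\<close>
      consider "l \<le> 0" | "l \<in> L" | "l > 0" "l \<notin> L" by linarith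
      then show ?thesis
      proof cases
        case 1
        have "?Q ** V = 0"
          by (rule injective_matrix_cancel[OF _ AQ]) (use pos_def_shift_kernel[OF P 1] lin in auto)
        then show ?thesis using L by blast
      next
        case 2
        let ?R = "poly_matrix (\<Prod>x\<in>L - {l}. [:- x, 1:]) P"
        have Q: "?Q = ?A ** ?R"
          unfolding root_product_split[OF L(1) 2] poly_matrix_mult ..
        have "?Q ** V = 0"
          unfolding matrix_eq
        proof
          fix y
          have "?A *v (?A *v (?R *v (V *v y))) = 0"
            using AQ unfolding Q by (simp add: matrix_vector_mul_assoc matrix_mul_assoc)
          moreover have "adj ?A = ?A" by (rule poly_matrix_hermitian[OF hP])
          ultimately have "?A *v (?R *v (V *v y)) = 0" by (metis hermitian_square_kernel)
          then show "(?Q ** V) *v y = 0 *v y" unfolding Q by (simp add: matrix_vector_mul_assoc matrix_mul_assoc)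
        qed
        then show ?thesis using L by blast
      next
        case 3
        have "poly_matrix (\<Prod>x\<in>insert l L. [:- x, 1:]) P ** V = 0"
          using AQ 3 L(1) by (simp only: prod.insert poly_matrix_mult not_False_eq_True) (simp add: matrix_mul_assoc)
        then show ?thesis using L 3 by (intro exI[of _ "insert l L"]) auto
      qed
    qed
  qed
qed

lemma root_product_dvd:
  fixes L :: "real set"
  assumes "finite L"
  shows "(\<forall>l\<in>L. poly f l = 0) \<Longrightarrow> (\<Prod>l\<in>L. [:- l, 1:]) dvd f"
  using assms
proof (induction L arbitrary: f rule: finite_induct)
  case (insert l L)
  then obtain g where g: "f = [:- l, 1:] * g" by (auto simp: poly_eq_0_iff_dvd elim!: dvdE)
  have "\<forall>x\<in>L. poly g x = 0"
  proof
    fix x assume "x \<in> L"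
    then have "poly f x = 0" "x \<noteq> l" using insert by auto
    then show "poly g x = 0" unfolding g by simp
  qed
  then have "(\<Prod>l\<in>L. [:- l, 1:]) dvd g" by (rule insert.IH)
  then show ?case unfolding g prod.insert[OF insert.hyps] by (rule mult_dvd_mono[OF dvd_refl])
qed simp

text \<open>Newton interpolation: the value at a new node is corrected by a multiple of the product
  that vanishes at the old nodes.\<close>

lemma interpolation:
  fixes L :: "real set"
  assumes "finite L"
  shows "\<exists>q. \<forall>l\<in>L. poly q l = f l"
  using assms
proof (induction L rule: finite_induct)
  case (insert l L)
  then obtain q where q: "\<forall>x\<in>L. poly q x = f x" by blast
  let ?w = "\<Prod>x\<in>L. [:- x, 1:]"
  have "poly ?w l \<noteq> 0" using insert.hyps by (auto simp: poly_prod)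
  moreover have "poly ?w x = 0" if "x \<in> L" for x
    using that insert.hyps by (auto simp: poly_prod)
  ultimately have "\<forall>x\<in>insert l L. poly (q + smult ((f l - poly q l) / poly ?w l) ?w) x = f x"
    using q by auto
  then show ?case by blast
qed simp

lemma pos_def_mat_1: "pos_def (mat 1)"
  unfolding pos_def_qdot using sqn_pos by (auto simp: qdot_self hermitian_def)

lemma pos_def_add:
  assumes "pos_def S" "pos_def T"
  shows "pos_def (S + T)"
  unfolding pos_def_qdot
proof (intro conjI allI impI)
  show "hermitian (S + T)" using assms by (simp add: pos_def_qdot hermitian_def)
  fix x :: "quat^'a" assume "x \<noteq> 0"
  then obtain s t where "s > 0" "t > 0" "qdot x (S *v x) = of_real s" "qdot x (T *v x) = of_real t"
    using assms unfolding pos_def_qdot by blast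
  then show "\<exists>t>0. qdot x ((S + T) *v x) = of_real t"
    by (intro exI[of _ "s + t"]) (simp add: matrix_vector_mult_add_rdistrib qdot_add)
qed

text \<open>
  The square root is \<open>T\<^sup>2\<close> with \<open>T\<close> a polynomial in \<open>P\<close> interpolating the fourth root, which
  makes its positivity evident; uniqueness follows as every square root commutes with it.
\<close>

lemma pos_def_msqrt:
  fixes P :: "quat^('n::{finite,linorder})^('n::{finite,linorder})"
  assumes P: "pos_def P"
  shows "pos_def (msqrt P)" "msqrt P ** msqrt P = P"
proof -
  have hP: "hermitian P" using pos_def_hermitian[OF P] .
  obtain p where "p \<noteq> 0" "poly_matrix p P = 0" using Cayley_Hamilton[OF hP] by blast
  then obtain L where L: "finite L" "\<forall>l\<in>L. l > 0" "poly_matrix (\<Prod>l\<in>L. [:- l, 1:]) P = 0"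
    using pos_def_annihilator[OF P, of p "mat 1"] by auto
  obtain q where q: "\<forall>l\<in>L. poly q l = sqrt (sqrt l)" using interpolation[OF L(1), of "\<lambda>l. sqrt (sqrt l)"] by blast
  define T where "T = poly_matrix q P"
  define S where "S = poly_matrix (q * q) P"
  have ST: "S = T ** T" by (simp add: S_def T_def poly_matrix_mult)
  \<comment> \<open>The fourth power of \<open>q\<close> agrees with the identity polynomial on
    \<open>L\<close>, hence modulo the product that annihilates \<open>P\<close>.\<close>
  have "poly (q * q * (q * q) - [:0, 1:]) l = 0" if "l \<in> L" for l
  proof -
    have "sqrt (sqrt l) * sqrt (sqrt l) = sqrt l" "sqrt l * sqrt l = l"
      using L(2) that by (auto simp: less_imp_le)
    then show ?thesis using q that by (simp only: poly_diff poly_mult) simp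
  qed
  then have "(\<Prod>l\<in>L. [:- l, 1:]) dvd q * q * (q * q) - [:0, 1:]" by (intro root_product_dvd L) auto
  then obtain g where "q * q * (q * q) - [:0, 1:] = (\<Prod>l\<in>L. [:- l, 1:]) * g" by (elim dvdE)
  then have "q * q * (q * q) = (\<Prod>l\<in>L. [:- l, 1:]) * g + [:0, 1:]" by (simp add: algebra_simps)
  then have "poly_matrix (q * q * (q * q)) P = P" using L(3) by (simp add: poly_matrix_mult)
  then have SS: "S ** S = P" unfolding S_def poly_matrix_mult[symmetric] .
  have adjT: "adj T = T" unfolding T_def by (rule poly_matrix_hermitian[OF hP])
  have "x = 0" if "T *v x = 0" for x
  proof -
    have "P *v x = S *v (T *v (T *v x))" by (simp add: matrix_vector_mul_assoc SS[symmetric] ST matrix_mul_assoc)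
    then show ?thesis using that pos_def_kernel[OF P, of x] by simp
  qed
  from pos_def_congruence[OF pos_def_mat_1, of T, OF this] have S: "pos_def S"
    using adjT by (simp add: ST)
  have "msqrt P = S"
    unfolding msqrt_def
  proof (rule the_equality)
    fix S' assume S': "pos_def S' \<and> S' ** S' = P"
    then have "S' ** S = S ** S'"
      unfolding S_def by (intro poly_matrix_commute) (metis matrix_mul_assoc)
    \<comment> \<open>Since \<open>S\<close> and \<open>S'\<close> commute, this is the difference
      of their squares; the left factor is positive definite and may be cancelled.\<close>
    then have "(S + S') ** (S' - S) = 0"
      using S' SS by (simp add: matrix_add_rdistrib matrix_mult_minus_distrib)
    moreover have "x = 0" if "(S + S') *v x = 0" for x
      using S S' by (intro pos_def_kernel[of "S + S'"] pos_def_add) (simp_all add: that)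
    ultimately have "S' - S = 0" by (rule injective_matrix_cancel[rotated])
    then show "S' = S" by simp
  qed (use S SS in simp)
  then show "pos_def (msqrt P)" "msqrt P ** msqrt P = P" using S SS by auto
qed

section \<open>Rank\<close>

text \<open>Gaussian elimination over the quaternions, with coefficients on the left and unknowns on
  the right. One equation with a nonzero coefficient eliminates one unknown, so there remain more
  unknowns than equations.\<close>

lemma homogeneous_system:
  fixes a :: "'i \<Rightarrow> 'j \<Rightarrow> quat"
  assumes "finite I" "finite S" "card I < card S"
  shows "\<exists>c. (\<exists>j\<in>S. c j \<noteq> 0) \<and> (\<forall>i\<in>I. (\<Sum>j\<in>S. a i j * c j) = 0)"
  using assms
proof (induction I arbitrary: S a rule: finite_induct)
  case empty
  then obtain j where "j \<in> S" by fastforce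
  then show ?case by (intro exI[of _ "\<lambda>_. 1"]) auto
next
  case (insert i\<^sub>0 I)
  show ?case
  proof (cases "\<forall>j\<in>S. a i\<^sub>0 j = 0")
    case True
    have "card I < card S" using insert by simp
    from insert.IH[OF insert.prems(1) this, of a]
    obtain c where "\<exists>j\<in>S. c j \<noteq> 0" "\<forall>i\<in>I. (\<Sum>j\<in>S. a i j * c j) = 0" by blast
    then show ?thesis using True by (intro exI[of _ c]) auto
  next
    case False
    then obtain p where p: "p \<in> S" "a i\<^sub>0 p \<noteq> 0" by blast
    define q where "q = inverse (a i\<^sub>0 p)"
    have pq: "a i\<^sub>0 p * q = 1" using p(2) by (simp add: q_def)
    let ?S = "S - {p}"
    have "card I < card ?S" using insert p by (simp add: card_Diff_singleton)
    from insert.IH[OF _ this, of "\<lambda>i j. a i j - a i p * q * a i\<^sub>0 j"] insert.prems(1)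
    obtain c where c: "\<exists>j\<in>?S. c j \<noteq> 0" "\<forall>i\<in>I. (\<Sum>j\<in>?S. (a i j - a i p * q * a i\<^sub>0 j) * c j) = 0"
      by blast
    define s where "s = (\<Sum>j\<in>?S. a i\<^sub>0 j * c j)"
    \<comment> \<open>The value at \<open>p\<close> is the one that equation
      \<open>i\<^sub>0\<close> forces.\<close>
    let ?c = "c(p := - (q * s))"
    have sum: "(\<Sum>j\<in>S. a i j * ?c j) = (\<Sum>j\<in>?S. a i j * c j) - a i p * q * s" for i
    proof -
      have "(\<Sum>j\<in>S. a i j * ?c j) = a i p * ?c p + (\<Sum>j\<in>?S. a i j * ?c j)"
        by (rule sum.remove) (use insert p in auto)
      moreover have "(\<Sum>j\<in>?S. a i j * ?c j) = (\<Sum>j\<in>?S. a i j * c j)"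
        by (rule sum.cong) auto
      ultimately show ?thesis by (simp add: mult.assoc)
    qed
    have "(\<Sum>j\<in>S. a i j * ?c j) = 0" if "i \<in> insert i\<^sub>0 I" for i
    proof (cases "i = i\<^sub>0")
      case True
      then show ?thesis unfolding sum using pq by (simp add: s_def)
    next
      case False
      then have "(\<Sum>j\<in>?S. (a i j - a i p * q * a i\<^sub>0 j) * c j) = 0" using c(2) that by blast
      then show ?thesis unfolding sum
        by (simp add: left_diff_distrib sum_subtractf mult.assoc s_def flip: sum_distrib_left)
    qed
    moreover have "\<exists>j\<in>S. ?c j \<noteq> 0" using c(1) by auto
    ultimately show ?thesis by blast
  qed
qed

lemma right_indep_cols_card: "right_indep_cols A S \<Longrightarrow> card S \<le> qrank A"
  unfolding qrank_def by (intro Max_ge) auto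

lemma right_indep_cols_max:
  fixes A :: "quat^'n^'m"
  obtains S where "right_indep_cols A S" "card S = qrank A"
proof -
  have "right_indep_cols A {}" by (simp add: right_indep_cols_def)
  then have "{S. right_indep_cols A S} \<noteq> {}" by blast
  then have "qrank A \<in> card ` {S. right_indep_cols A S}"
    unfolding qrank_def by (intro Max_in) auto
  then show ?thesis using that by auto
qed

text \<open>By maximality, adjoining column \<open>l\<close> creates a dependency. Its coefficient
  at \<open>l\<close> is nonzero, as \<open>S\<close> is independent, and can be inverted from the
  right.\<close>

lemma right_indep_cols_span:
  fixes A :: "quat^'n^'m"
  assumes S: "right_indep_cols A S" "card S = qrank A"
  shows "\<exists>e. \<forall>i. A $ i $ l = (\<Sum>s\<in>S. A $ i $ s * e s)"
proof (cases "l \<in> S")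
  case True
  have "A $ i $ l = (\<Sum>s\<in>S. A $ i $ s * (if s = l then 1 else 0))" for i
    using True by (simp add: if_distrib cong: if_cong)
  then show ?thesis by (intro exI[of _ "\<lambda>s. if s = l then 1 else 0"]) blast
next
  case False
  then have "\<not> right_indep_cols A (insert l S)"
    using right_indep_cols_card[of A "insert l S"] S(2) by auto
  then obtain c j where c: "\<And>i. (\<Sum>j\<in>insert l S. A $ i $ j * c j) = 0" "j \<in> insert l S" "c j \<noteq> 0"
    unfolding right_indep_cols_def by blast
  have sum: "A $ i $ l * c l + (\<Sum>j\<in>S. A $ i $ j * c j) = 0" for i
    using c(1)[of i] False by simp
  have "c l \<noteq> 0"
  proof
    assume "c l = 0"
    then have "\<forall>i. (\<Sum>j\<in>S. A $ i $ j * c j) = 0" using sum by simp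
    then have "\<forall>j\<in>S. c j = 0" using S(1) unfolding right_indep_cols_def by blast
    then show False using c \<open>c l = 0\<close> by auto
  qed
  have "A $ i $ l = (\<Sum>s\<in>S. A $ i $ s * (- (c s * inverse (c l))))" for i
  proof -
    have "A $ i $ l = (A $ i $ l * c l) * inverse (c l)"
      using \<open>c l \<noteq> 0\<close> by (simp add: mult.assoc)
    also have "A $ i $ l * c l = - (\<Sum>j\<in>S. A $ i $ j * c j)"
      using sum[of i] by (simp add: eq_neg_iff_add_eq_0)
    finally show ?thesis by (simp add: sum_distrib_right sum_negf mult.assoc)
  qed
  then show ?thesis by (intro exI[of _ "\<lambda>s. - (c s * inverse (c l))"]) blast
qed

text \<open>The columns of \<open>A ** R\<close> lie in the right span of \<open>qrank A\<close>
  columns of \<open>A\<close>; by \<open>homogeneous_system\<close>, more than that many of them are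
  dependent.\<close>

lemma qrank_mult_le: "qrank (A ** R) \<le> qrank A" for A :: "quat^'n^'m" and R :: "quat^'p^'n"
proof (rule ccontr)
  assume *: "\<not> qrank (A ** R) \<le> qrank A"
  obtain T where T: "right_indep_cols (A ** R) T" "card T = qrank (A ** R)"
    using right_indep_cols_max by blast
  obtain S where S: "right_indep_cols A S" "card S = qrank A"
    using right_indep_cols_max by blast
  obtain e where e: "\<And>i l. A $ i $ l = (\<Sum>s\<in>S. A $ i $ s * e l s)"
    using right_indep_cols_span[OF S] by metis
  define a where "a s l = (\<Sum>j\<in>UNIV. e j s * R $ j $ l)" for s l
  have AR: "(A ** R) $ i $ l = (\<Sum>s\<in>S. A $ i $ s * a s l)" for i l
  proof -
    have "(A ** R) $ i $ l = (\<Sum>j\<in>UNIV. (\<Sum>s\<in>S. A $ i $ s * e j s) * R $ j $ l)"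
      unfolding matrix_matrix_mult_def by (simp flip: e)
    also have "\<dots> = (\<Sum>j\<in>UNIV. \<Sum>s\<in>S. A $ i $ s * (e j s * R $ j $ l))"
      by (simp add: sum_distrib_right mult.assoc)
    also have "\<dots> = (\<Sum>s\<in>S. \<Sum>j\<in>UNIV. A $ i $ s * (e j s * R $ j $ l))"
      by (rule sum.swap)
    finally show ?thesis by (simp add: a_def sum_distrib_left)
  qed
  obtain c where c: "\<exists>j\<in>T. c j \<noteq> 0" "\<forall>s\<in>S. (\<Sum>l\<in>T. a s l * c l) = 0"
    using homogeneous_system[of S T a] * S(2) T(2) by auto
  have "(\<Sum>l\<in>T. (A ** R) $ i $ l * c l) = 0" for i
  proof -
    have "(\<Sum>l\<in>T. (A ** R) $ i $ l * c l) = (\<Sum>l\<in>T. \<Sum>s\<in>S. A $ i $ s * (a s l * c l))"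
      by (simp add: AR sum_distrib_right mult.assoc)
    also have "\<dots> = (\<Sum>s\<in>S. \<Sum>l\<in>T. A $ i $ s * (a s l * c l))"
      by (rule sum.swap)
    also have "\<dots> = 0" using c(2) by (simp flip: sum_distrib_left)
    finally show ?thesis .
  qed
  then show False using T(1) c(1) unfolding right_indep_cols_def by blast
qed

lemma qrank_mult_invertible:
  fixes A :: "quat^'n^'m"
  assumes "R ** R' = mat 1"
  shows "qrank (A ** R) = qrank A"
  using qrank_mult_le[of A R] qrank_mult_le[of "A ** R" R'] assms
  by (simp flip: matrix_mul_assoc)

lemma right_indep_cols_kernel:
  fixes K :: "quat^'n^'m"
  shows "right_indep_cols K \<beta> \<longleftrightarrow> (\<forall>x. (\<forall>i. i \<notin> \<beta> \<longrightarrow> x $ i = 0) \<longrightarrow> K *v x = 0 \<longrightarrow> x = 0)"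
proof
  assume ind: "right_indep_cols K \<beta>"
  show "\<forall>x. (\<forall>i. i \<notin> \<beta> \<longrightarrow> x $ i = 0) \<longrightarrow> K *v x = 0 \<longrightarrow> x = 0"
  proof (intro allI impI)
    fix x assume x: "\<forall>i. i \<notin> \<beta> \<longrightarrow> x $ i = 0" "K *v x = 0"
    have "(\<Sum>j\<in>\<beta>. K $ i $ j * x $ j) = (K *v x) $ i" for i
      unfolding matrix_vector_mult_def vec_lambda_beta
      by (rule sum.mono_neutral_left) (use x(1) in auto)
    then have "\<forall>j\<in>\<beta>. x $ j = 0"
      using ind x(2) unfolding right_indep_cols_def by (metis zero_index)
    then show "x = 0" using x(1) by (auto simp: vec_eq_iff)
  qed
next
  assume ker: "\<forall>x. (\<forall>i. i \<notin> \<beta> \<longrightarrow> x $ i = 0) \<longrightarrow> K *v x = 0 \<longrightarrow> x = 0"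
  show "right_indep_cols K \<beta>"
    unfolding right_indep_cols_def
  proof (intro allI impI ballI)
    fix c j assume c: "\<forall>i. (\<Sum>j\<in>\<beta>. K $ i $ j * c j) = 0" and j: "j \<in> \<beta>"
    define x where "x = (\<chi> i. if i \<in> \<beta> then c i else 0)"
    have "(K *v x) $ i = (\<Sum>j\<in>\<beta>. K $ i $ j * c j)" for i
      unfolding matrix_vector_mult_def vec_lambda_beta
      by (rule sum.mono_neutral_cong_right) (auto simp: x_def)
    then have "K *v x = 0" using c by (simp add: vec_eq_iff)
    moreover have "\<forall>i. i \<notin> \<beta> \<longrightarrow> x $ i = 0" by (simp add: x_def)
    ultimately have "x = 0" using ker by blast
    then have "x $ j = 0" by simp
    then show "c j = 0" using j by (simp add: x_def)
  qed
qed

section \<open>The determinantal representation\<close>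

text \<open>Turns the numerators of the representation into entries of a matrix product.\<close>

lemma sum_cdet_replace_col:
  "(\<Sum>\<beta>\<in>J_at s k. cdet \<beta> k (replace_col G k f)) = (cof_sum s G *v f) $ k"
proof -
  have "(\<Sum>\<beta>\<in>J_at s k. cdet \<beta> k (replace_col G k f)) = (\<Sum>\<beta>\<in>J_at s k. \<Sum>i\<in>UNIV. cof \<beta> G k i * f $ i)"
    by (intro sum.cong refl cdet_replace_col) (simp add: J_at_def)
  also have "\<dots> = (\<Sum>i\<in>UNIV. \<Sum>\<beta>\<in>J_at s k. cof \<beta> G k i * f $ i)"
    by (rule sum.swap)
  finally show ?thesis by (simp add: cof_sum_def matrix_vector_mult_def sum_distrib_right)
qed

section \<open>Gram matrices for the inner product given by \<open>M\<close>\<close>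

context
  fixes K :: "quat^('n::{finite,linorder})^'m" and M :: "quat^'m^'m"
    and G :: "quat^('n::{finite,linorder})^('n::{finite,linorder})"
  assumes M: "pos_def M" and G_def: "G = adj K ** M ** K"
begin

lemma gram_hermitian: "hermitian G"
  unfolding G_def by (rule hermitian_congruence[OF pos_def_hermitian[OF M]])

lemma gram_kernel: "qdot x (G *v x) = 0 \<Longrightarrow> K *v x = 0"
  unfolding G_def qdot_congruence by (rule pos_def_kernel[OF M])

lemma gram_mult: "K *v x = 0 \<Longrightarrow> G *v x = 0"
  by (simp add: G_def flip: matrix_vector_mul_assoc)

lemma gram_mdet_pos:
  assumes "right_indep_cols K \<beta>"
  shows "qRe (mdet \<beta> G) > 0"
proof (rule mdet_pos[OF gram_hermitian])
  fix x :: "quat^('n::{finite,linorder})" assume "x \<noteq> 0" "\<And>i. i \<notin> \<beta> \<Longrightarrow> x $ i = 0"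
  then have "K *v x \<noteq> 0" using assms unfolding right_indep_cols_kernel by blast
  then show "\<exists>t>0. qdot x (G *v x) = of_real t"
    using M unfolding G_def qdot_congruence pos_def_qdot by blast
qed

text \<open>A nonzero kernel vector \<open>x\<close> supported on \<open>\<beta>\<close> satisfies
  \<open>G *v x = 0\<close>; applying the cofactors of row \<open>k\<close> yields
  \<open>mdet \<beta> G * x $ k = 0\<close>.\<close>

lemma gram_mdet_zero:
  assumes "\<not> right_indep_cols K \<beta>"
  shows "mdet \<beta> G = 0"
proof -
  obtain x where x: "\<And>i. i \<notin> \<beta> \<Longrightarrow> x $ i = 0" "K *v x = 0" "x \<noteq> 0"
    using assms unfolding right_indep_cols_kernel by blast
  then obtain k where k: "x $ k \<noteq> 0" by (auto simp: vec_eq_iff)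
  then have kb: "k \<in> \<beta>" using x(1) by blast
  have "0 = (\<Sum>i\<in>UNIV. cof \<beta> G k i * (G *v x) $ i)"
    using gram_mult[OF x(2)] by simp
  also have "\<dots> = (\<Sum>i\<in>UNIV. \<Sum>l\<in>UNIV. cof \<beta> G k i * G $ i $ l * x $ l)"
    by (simp add: matrix_vector_mult_def sum_distrib_left mult.assoc)
  also have "\<dots> = (\<Sum>l\<in>UNIV. \<Sum>i\<in>UNIV. cof \<beta> G k i * G $ i $ l * x $ l)"
    by (rule sum.swap)
  also have "\<dots> = (\<Sum>l\<in>UNIV. if l = k then mdet \<beta> G * x $ k else 0)"
  proof (rule sum.cong[OF refl])
    fix l
    show "(\<Sum>i\<in>UNIV. cof \<beta> G k i * G $ i $ l * x $ l) = (if l = k then mdet \<beta> G * x $ k else 0)"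
      using cof_mult_column[OF gram_hermitian kb, of l] x(1)[of l] kb
      by (cases "l \<in> \<beta>") (auto simp flip: sum_distrib_right)
  qed
  finally show ?thesis using k by simp
qed

text \<open>No principal minor is negative, and a maximal independent set of columns contributes a
  positive one.\<close>

lemma minor_sum_gram_pos: "minor_sum (qrank K) G > 0"
proof -
  obtain S where S: "right_indep_cols K S" "card S = qrank K"
    using right_indep_cols_max by blast
  have "qRe (mdet \<beta> G) \<ge> 0" for \<beta>
    using gram_mdet_pos[of \<beta>] gram_mdet_zero[of \<beta>] by (cases "right_indep_cols K \<beta>") auto
  then show ?thesis
    unfolding minor_sum_def using gram_mdet_pos[OF S(1)] S(2)
    by (intro sum_pos2[of _ S]) (auto simp: J_def)
qed

text \<open>Minors of order above the rank vanish, so the form vanishes at each cofactor row of that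
  order. A semidefinite form vanishes only on the kernel of \<open>G\<close>, so \<open>G\<close>
  annihilates these rows.\<close>

lemma cof_sum_gram_zero: "cof_sum (Suc (qrank K)) G ** G = 0"
proof -
  have "(\<Sum>i\<in>UNIV. cof \<beta> G k i * G $ i $ l) = 0" if \<beta>: "\<beta> \<in> J_at (Suc (qrank K)) k" for \<beta> k l
  proof -
    have "\<not> right_indep_cols K \<beta>"
      using \<beta> right_indep_cols_card[of K \<beta>] by (auto simp: J_at_def J_def)
    then have "qdot (cof_row \<beta> G k) (G *v cof_row \<beta> G k) = 0"
      using \<beta> by (simp add: qdot_cof_row[OF gram_hermitian] gram_mdet_zero J_at_def)
    then have "G *v cof_row \<beta> G k = 0" by (intro gram_mult gram_kernel)
    then have "qcnj (\<Sum>i\<in>UNIV. cof \<beta> G k i * G $ i $ l) = 0"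
      unfolding matrix_cof_row[OF gram_hermitian, symmetric] by simp
    then show ?thesis by (metis qcnj_simps(5,7))
  qed
  moreover have "(cof_sum s G ** G) $ k $ l = (\<Sum>\<beta>\<in>J_at s k. \<Sum>i\<in>UNIV. cof \<beta> G k i * G $ i $ l)" for s k l
    unfolding matrix_matrix_mult_def cof_sum_def by (simp add: sum_distrib_right) (rule sum.swap)
  ultimately show ?thesis by (simp add: vec_eq_iff)
qed

text \<open>
  By the recursion, \<open>cof_sum r G / minor_sum r G\<close> commutes with \<open>G\<close> and its product with \<open>G\<close> is
  the orthogonal projection onto the range of \<open>G\<close>.
\<close>

lemma gram_generalized_inverse:
  defines "T \<equiv> (1 / minor_sum (qrank K) G) *\<^sub>R cof_sum (qrank K) G"
  shows "adj T = T" "T ** G = G ** T" "K ** (T ** G) = K" "(T ** G) ** adj K = adj K"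
proof -
  note poly = cof_sum_polynomial[OF gram_hermitian, of "qrank K"]
  show adj: "adj T = T" using poly by (simp add: T_def)
  show comm: "T ** G = G ** T" using poly by (simp add: T_def matrix_scalar_ac flip: scalar_matrix_assoc)
  have "cof_sum (qrank K) G ** G = minor_sum (qrank K) G *\<^sub>R mat 1 - cof_sum (Suc (qrank K)) G"
    using cof_sum_Suc[OF gram_hermitian, of "qrank K"] by (simp add: algebra_simps)
  then have "cof_sum (qrank K) G ** G ** G = minor_sum (qrank K) G *\<^sub>R G"
    using cof_sum_gram_zero by (simp add: matrix_mult_minus_distrib flip: scalar_matrix_assoc)
  then have "T ** G ** G = G"
    using minor_sum_gram_pos by (simp add: T_def flip: scalar_matrix_assoc)
  then have "G ** (T ** G) = G" using comm by (metis matrix_mul_assoc)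
  then have GZ: "G ** (mat 1 - T ** G) = 0" by (simp add: matrix_mult_minus_distrib)
  \<comment> \<open>The identity passes from \<open>G\<close> to \<open>K\<close> because the kernel
    of \<open>G\<close> is contained in that of \<open>K\<close>.\<close>
  have "K ** (mat 1 - T ** G) = 0"
    unfolding matrix_eq
  proof
    fix x
    have "G *v ((mat 1 - T ** G) *v x) = 0" using GZ by (simp add: matrix_vector_mul_assoc)
    then have "K *v ((mat 1 - T ** G) *v x) = 0" by (intro gram_kernel) simp
    then show "K ** (mat 1 - T ** G) *v x = 0 *v x" by (simp add: matrix_vector_mul_assoc)
  qed
  then show KP: "K ** (T ** G) = K" by (simp add: matrix_mult_minus_distrib)
  have "adj (T ** G) = T ** G"
    using adj comm hermitian_adj[OF gram_hermitian] by simp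
  then show "(T ** G) ** adj K = adj K"
    using arg_cong[OF KP, of adj] by simp
qed

end

section \<open>The weighted Moore-Penrose inverse\<close>

lemma pos_def_mult_cancel:
  assumes "pos_def P" "P ** X = P ** Y"
  shows "X = Y"
proof -
  have "P ** (X - Y) = 0" using assms(2) by (simp add: matrix_mult_minus_distrib)
  moreover have "x = 0" if "P *v x = 0" for x
    using pos_def_kernel[OF assms(1), of x] that by simp
  ultimately have "X - Y = 0" by (rule injective_matrix_cancel[rotated])
  then show ?thesis by simp
qed

text \<open>Penrose's uniqueness argument with weights. Inserting \<open>A ** Y ** A\<close> for
  \<open>A\<close> and taking adjoints gives \<open>A ** X = A ** Y\<close> and
  \<open>X ** A = Y ** A\<close> once \<open>M\<close> and \<open>N\<close> are cancelled; then
  \<open>X = X ** A ** Y = Y\<close>.\<close>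

lemma weighted_pinv_eqI:
  assumes M: "pos_def M" and N: "pos_def N"
    and X: "A ** X ** A = A" "X ** A ** X = X" "hermitian (M ** A ** X)" "hermitian (N ** X ** A)"
  shows "weighted_pinv M N A = X"
  unfolding weighted_pinv_def
proof (rule the_equality)
  note adj = hermitian_adj[OF pos_def_hermitian[OF M]] hermitian_adj[OF pos_def_hermitian[OF N]]
  fix Y assume "A ** Y ** A = A \<and> Y ** A ** Y = Y \<and> hermitian (M ** A ** Y) \<and> hermitian (N ** Y ** A)"
  then have Y: "A ** Y ** A = A" "Y ** A ** Y = Y" "hermitian (M ** A ** Y)" "hermitian (N ** Y ** A)"
    by auto
  note herm = X(3,4) Y(3,4)
  note herm = herm[unfolded hermitian_def]
  have "M ** (A ** X) = adj (M ** (A ** Y ** A) ** X)"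
    unfolding Y(1) herm(1) by (rule matrix_mul_assoc)
  also have "\<dots> = adj (A ** X) ** adj (M ** A ** Y)"
    by (simp add: matrix_mul_assoc)
  also have "\<dots> = adj (M ** A ** X) ** A ** Y"
    unfolding herm(3) by (simp add: adj matrix_mul_assoc)
  also have "\<dots> = M ** (A ** X ** A) ** Y"
    unfolding herm(1) by (simp add: matrix_mul_assoc)
  finally have "M ** (A ** X) = M ** (A ** Y)"
    unfolding X(1) by (simp only: matrix_mul_assoc)
  then have AX: "A ** X = A ** Y" by (rule pos_def_mult_cancel[OF M])
  have "N ** (X ** A) = adj (N ** X ** (A ** Y ** A))"
    unfolding Y(1) herm(2) by (rule matrix_mul_assoc)
  also have "\<dots> = adj (Y ** A) ** adj (N ** X ** A)"
    by (simp add: matrix_mul_assoc)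
  also have "\<dots> = adj (N ** Y ** A) ** X ** A"
    unfolding herm(2) by (simp add: adj matrix_mul_assoc)
  also have "\<dots> = N ** Y ** (A ** X ** A)"
    unfolding herm(4) by (simp add: matrix_mul_assoc)
  finally have "N ** (X ** A) = N ** (Y ** A)"
    unfolding X(1) by (simp only: matrix_mul_assoc)
  then have XA: "X ** A = Y ** A" by (rule pos_def_mult_cancel[OF N])
  show "Y = X"
    using X(2) Y(2) AX XA by (metis matrix_mul_assoc)
qed (use X in simp)

text \<open>The substitution \<open>K = A ** R\<close> absorbs the weight \<open>N\<close>:
  \<open>X ** A\<close> becomes similar, through \<open>R\<close>, to the orthogonal projection
  \<open>T ** G\<close>, and \<open>N ** X ** A\<close> becomes congruent to it.\<close>

lemma weighted_pinv_cof_sum: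
  fixes A :: "quat^('n::{finite,linorder})^'m"
    and N :: "quat^('n::{finite,linorder})^('n::{finite,linorder})"
  assumes M: "pos_def M" and N: "pos_def N"
  defines "R \<equiv> msqrt (matrix_inv N)"
  defines "G \<equiv> R ** adj A ** M ** A ** R"
  shows "weighted_pinv M N A =
    R ** ((1 / minor_sum (qrank A) G) *\<^sub>R cof_sum (qrank A) G) ** (R ** adj A ** M)"
proof -
  note Ninv = pos_def_inverse[OF N]
  have R: "pos_def R" "R ** R = matrix_inv N"
    unfolding R_def using pos_def_msqrt[OF Ninv(3)] by auto
  have adjR: "adj R = R" using hermitian_adj[OF pos_def_hermitian[OF R(1)]] .
  define R' where "R' = matrix_inv R"
  have R': "R ** R' = mat 1" "R' ** R = mat 1" and "pos_def R'"
    unfolding R'_def using pos_def_inverse[OF R(1)] by auto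
  then have adjR': "adj R' = R'" using hermitian_adj pos_def_hermitian by blast
  \<comment> \<open>As \<open>R\<close> is a square root of the inverse of \<open>N\<close>, its own
    inverse \<open>R'\<close> is a square root of \<open>N\<close>.\<close>
  have NR: "N = R' ** R'"
  proof -
    have "N = N ** (R ** R) ** (R' ** R')"
      using R' by (metis matrix_mul_assoc matrix_mul_rid)
    then show ?thesis using R(2) Ninv(1) by simp
  qed
  define K where "K = A ** R"
  have adjK: "adj K = R ** adj A" by (simp add: K_def adjR)
  have rank: "qrank K = qrank A" unfolding K_def by (rule qrank_mult_invertible[OF R'(1)])
  have G: "G = adj K ** M ** K" unfolding adjK unfolding G_def K_def by (simp only: matrix_mul_assoc)
  define T where "T = (1 / minor_sum (qrank A) G) *\<^sub>R cof_sum (qrank A) G"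
  note T = gram_generalized_inverse[OF M G, unfolded rank, folded T_def]
  have A: "A = K ** R'" using R'(1) by (simp add: K_def flip: matrix_mul_assoc)
  define X where "X = R ** T ** (adj K ** M)"
  have AX: "A ** X = K ** T ** adj K ** M"
    unfolding X_def K_def by (simp add: matrix_mul_assoc)
  have XA: "X ** A = R ** (T ** G) ** R'"
    unfolding X_def G A by (simp add: matrix_mul_assoc)
  have "weighted_pinv M N A = X"
  proof (rule weighted_pinv_eqI[OF M N])
    have "A ** X ** A = A ** R ** (T ** G) ** R'"
      using XA by (metis matrix_mul_assoc)
    also have "\<dots> = A" unfolding K_def[symmetric] T(3) A[symmetric] ..
    finally show "A ** X ** A = A" .
    have "X ** A ** X = R ** (T ** G) ** (R' ** R) ** T ** (adj K ** M)"
      unfolding XA by (simp add: X_def matrix_mul_assoc)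
    also have "\<dots> = R ** T ** (G ** T) ** adj K ** M"
      unfolding R'(2) by (simp add: matrix_mul_assoc)
    also have "\<dots> = R ** T ** ((T ** G) ** adj K) ** M"
      unfolding T(2) by (simp add: matrix_mul_assoc)
    also have "\<dots> = X" unfolding T(4) X_def by (simp add: matrix_mul_assoc)
    finally show "X ** A ** X = X" .
    show "hermitian (M ** A ** X)"
      using hermitian_adj[OF pos_def_hermitian[OF M]] T(1)
      unfolding hermitian_def matrix_mul_assoc[symmetric, of M A] AX by (simp add: matrix_mul_assoc)
    have "N ** X ** A = R' ** R' ** (X ** A)"
      unfolding NR by (simp only: matrix_mul_assoc)
    also have "\<dots> = R' ** (R' ** R) ** (T ** G) ** R'"
      unfolding XA by (simp only: matrix_mul_assoc)
    also have "\<dots> = R' ** (T ** G) ** R'" unfolding R'(2) by simp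
    finally have "N ** X ** A = R' ** (T ** G) ** R'" .
    moreover have "hermitian (T ** G)"
      using T(1,2) hermitian_adj[OF gram_hermitian[OF M G]] by (simp add: hermitian_def)
    ultimately show "hermitian (N ** X ** A)"
      using hermitian_congruence[of "T ** G" R'] by (simp only: adjR')
  qed
  then show "weighted_pinv M N A = R ** ((1 / minor_sum (qrank A) G) *\<^sub>R cof_sum (qrank A) G) ** (R ** adj A ** M)"
    unfolding X_def T_def adjK .
qed

text \<open>Full column rank makes the Gram matrix invertible, and \<open>X\<close> is then a left
  inverse of \<open>A\<close>. The condition on \<open>N ** X ** A\<close> thus only says that
  \<open>N\<close> is Hermitian.\<close>

lemma weighted_pinv_full_rank:
  fixes A :: "quat^('n::{finite,linorder})^'m"
    and N :: "quat^('n::{finite,linorder})^('n::{finite,linorder})"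
  assumes M: "pos_def M" and N: "pos_def N"
    and rank: "qrank A = CARD('n)"
  defines "G \<equiv> adj A ** M ** A"
  shows "pos_def G" and "weighted_pinv M N A = (1 / qRe (mdet UNIV G)) *\<^sub>R cof_sum CARD('n) G ** (adj A ** M)"
proof -
  obtain S where "right_indep_cols A S" "card S = CARD('n)"
    using right_indep_cols_max rank by metis
  then have "right_indep_cols A UNIV" using card_subset_eq[of UNIV S] by simp
  then have "x = 0" if "A *v x = 0" for x using that unfolding right_indep_cols_kernel by simp
  then show G: "pos_def G" unfolding G_def by (intro pos_def_congruence[OF M])
  note h = pos_def_hermitian[OF G]
  define C where "C = (1 / qRe (mdet UNIV G)) *\<^sub>R cof_sum CARD('n) G"
  have CG: "C ** G = mat 1"
    using pos_def_mdet_pos[OF G] cof_sum_inverse[OF h] by (simp add: C_def flip: scalar_matrix_assoc)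
  have adjC: "adj C = C" using cof_sum_polynomial[OF h] by (simp add: C_def)
  define X where "X = C ** (adj A ** M)"
  have XA: "X ** A = mat 1" using CG by (simp add: X_def G_def matrix_mul_assoc)
  have "weighted_pinv M N A = X"
  proof (rule weighted_pinv_eqI[OF M N])
    show "A ** X ** A = A" using XA by (simp flip: matrix_mul_assoc)
    show "X ** A ** X = X" using XA by simp
    show "hermitian (N ** X ** A)"
      using XA pos_def_hermitian[OF N] by (simp flip: matrix_mul_assoc)
    show "hermitian (M ** A ** X)"
      using hermitian_adj[OF pos_def_hermitian[OF M]] adjC
      unfolding hermitian_def X_def by (simp add: matrix_mul_assoc)
  qed
  then show "weighted_pinv M N A = (1 / qRe (mdet UNIV G)) *\<^sub>R cof_sum CARD('n) G ** (adj A ** M)"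
    by (simp add: X_def C_def)
qed

text \<open>The bound \<open>1 \<le> r\<close> keeps the index sets nonempty, where
  \<open>hdet\<close> is determined.\<close>

lemma sum_hdet:
  fixes G :: "quat^('n::{finite,linorder})^('n::{finite,linorder})"
  assumes "hermitian G" "1 \<le> r"
  shows "(\<Sum>\<beta>\<in>J r. hdet \<beta> G) = minor_sum r G"
  unfolding minor_sum_def
  by (intro sum.cong refl hdet_eq assms) (use assms in \<open>auto simp: J_def\<close>)

theorem theorem5p3:
  fixes A :: "quat^('n::{finite,linorder})^'m"
    and M :: "quat^'m^'m" and N :: "quat^('n::{finite,linorder})^('n::{finite,linorder})" and b :: "quat^'m"
  assumes "pos_def M" and "pos_def N"
    and "\<not> hermitian (weighted_adj M N A ** A)"
  shows "(\<forall>r. qrank A = r \<and> 1 \<le> r \<and> r \<le> CARD('m) \<and> CARD('m) < CARD('n) \<longrightarrow>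
            (let R = msqrt (matrix_inv N);
                 G = R ** adj A ** M ** A ** R;
                 f = (R ** adj A ** M) *v b
             in \<forall>i. weighted_solution M N A b $ i =
                  (\<Sum>k\<in>UNIV. R $ i $ k * (\<Sum>\<beta>\<in>J_at r k. cdet \<beta> k (replace_col G k f)))
                    /\<^sub>R (\<Sum>\<beta>\<in>J r. hdet \<beta> G))) \<and>
         (qrank A = CARD('n) \<longrightarrow>
            (let G = adj A ** M ** A;
                 f = (adj A ** M) *v b
             in \<forall>i. weighted_solution M N A b $ i =
                  cdet UNIV i (replace_col G i f) /\<^sub>R hdet UNIV G))"
proof (intro conjI allI impI)
  fix r assume r: "qrank A = r \<and> 1 \<le> r \<and> r \<le> CARD('m) \<and> CARD('m) < CARD('n)"
  define R where "R = msqrt (matrix_inv N)"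
  define G where "G = R ** adj A ** M ** A ** R"
  define f where "f = (R ** adj A ** M) *v b"
  have R: "adj R = R"
    unfolding R_def using pos_def_msqrt(1)[OF pos_def_inverse(3)[OF assms(2)]]
    by (intro hermitian_adj pos_def_hermitian)
  have "G = adj (A ** R) ** M ** (A ** R)"
    unfolding G_def by (simp add: R matrix_mul_assoc)
  then have G: "hermitian G"
    using hermitian_congruence[OF pos_def_hermitian[OF assms(1)], of "A ** R"] by (simp only:)
  have "weighted_pinv M N A = R ** ((1 / minor_sum r G) *\<^sub>R cof_sum r G) ** (R ** adj A ** M)"
    using weighted_pinv_cof_sum[OF assms(1,2), of A, folded R_def, folded G_def] r by simp
  then have "weighted_solution M N A b = R *v ((1 / minor_sum r G) *\<^sub>R (cof_sum r G *v f))"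
    unfolding weighted_solution_def f_def
    by (simp only: matrix_vector_mul_assoc[symmetric] scaleR_matrix_vector)
  then have "weighted_solution M N A b $ i =
      (\<Sum>k\<in>UNIV. R $ i $ k * (cof_sum r G *v f) $ k) /\<^sub>R minor_sum r G" for i
    by (simp add: matrix_vector_mult_def[of R] scaleR_sum_right divide_inverse)
  then show "let R = msqrt (matrix_inv N); G = R ** adj A ** M ** A ** R; f = (R ** adj A ** M) *v b
      in \<forall>i. weighted_solution M N A b $ i =
        (\<Sum>k\<in>UNIV. R $ i $ k * (\<Sum>\<beta>\<in>J_at r k. cdet \<beta> k (replace_col G k f)))
          /\<^sub>R (\<Sum>\<beta>\<in>J r. hdet \<beta> G)"
    using r unfolding Let_def R_def[symmetric] G_def[symmetric] f_def[symmetric] sum_cdet_replace_col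
    by (simp add: sum_hdet[OF G])
next
  assume rank: "qrank A = CARD('n)"
  define G where "G = adj A ** M ** A"
  define f where "f = (adj A ** M) *v b"
  have G: "pos_def G"
    unfolding G_def by (rule weighted_pinv_full_rank(1)[OF assms(1,2) rank])
  \<comment> \<open>The full index set is the only one of order \<open>CARD('n)\<close>, so the sum
    of column determinants has a single term.\<close>
  have J: "J_at CARD('n) i = {UNIV}" for i :: 'n
    by (auto simp: J_at_def J_card)
  have "weighted_solution M N A b = (1 / qRe (mdet UNIV G)) *\<^sub>R (cof_sum CARD('n) G *v f)"
    unfolding weighted_solution_def weighted_pinv_full_rank(2)[OF assms(1,2) rank] f_def G_def
    by (simp only: matrix_vector_mul_assoc[symmetric] scaleR_matrix_vector)
  then have "weighted_solution M N A b $ i = cdet UNIV i (replace_col G i f) /\<^sub>R qRe (mdet UNIV G)" for i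
    using sum_cdet_replace_col[where k = i and s = "CARD('n)" and G = G and f = f] by (simp add: J divide_inverse)
  then show "let G = adj A ** M ** A; f = (adj A ** M) *v b
      in \<forall>i. weighted_solution M N A b $ i = cdet UNIV i (replace_col G i f) /\<^sub>R hdet UNIV G"
    unfolding Let_def G_def[symmetric] f_def[symmetric]
    by (simp add: hdet_eq[OF pos_def_hermitian[OF G]])
qed

end
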